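(* Suppose that the standing assumptions (SA1), (SA2), (SA3) of the context hold and that PI is recursively feasible, i.e. $H^i(x)\neq\emptyset$ for every $i\in\mathbb{Z}_{>0}$ and every $x\in\mathbb{R}^{n_x}$. Then, for any $i\in\mathbb{Z}_{\ge0}$ and $x\in\mathbb{R}^{n_x}$, $$(V^i-V^\star)(x)\le(V^0-V^\star)(\phi(i,x,h^\star)),$$ where $h^\star\in H^\star$ is a selection of the optimal input map. Moreover, for any $i\in\mathbb{Z}_{\ge0}$ and $x\in\mathbb{R}^{n_x}$, $$V^i(x)-V^\star(x)\le\widetilde\alpha(\beta(\sigma(x),i)),$$ where $\beta\in\mathcal{KL}$ is $\beta(s,k)=\underline\alpha_Y^{-1}\circ(\mathbb{I}-\widetilde\alpha_Y)^{(k)}\circ\overline\alpha_Y(s)$ and $\widetilde\alpha(s)=\max_{\hat s\in[0,s]}\widehat\alpha(\hat s)$ is a non-decreasing and positive definite function, with $\underline\alpha_Y,\overline\alpha_Y,\widetilde\alpha_Y,\widehat\alpha$ defined in the context.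
   Context: Notation. $\mathbb{R}_{\ge0}=[0,\infty)$, $\mathbb{Z}_{\ge0}=\{0,1,\dots\}$, $\mathbb{Z}_{>0}=\{1,2,\dots\}$. $\mathbb{I}$ is the identity on $\mathbb{R}_{\ge0}$; $g^{(k)}$ is the $k$-fold composition of $g$ with itself, $g^{(0)}=\mathbb{I}$. $\mathcal{K}_\infty$: continuous, strictly increasing, unbounded functions $\mathbb{R}_{\ge0}\to\mathbb{R}_{\ge0}$ that are zero at zero. $\mathcal{KL}$: functions $\beta(s,k)\ge0$ of $s\in\mathbb{R}_{\ge0}$ and $k$ (here $k\in\mathbb{Z}_{\ge0}$), nondecreasing in $s$ with $\lim_{s\to0^+}\beta(s,k)=0$ for each $k$, and nonincreasing in $k$ with $\lim_{k\to\infty}\beta(s,k)=0$ for each $s$. A function on $\mathbb{R}_{\ge0}$ is positive definite if it is zero at zero and positive elsewhere. A selection of a set-valued map $S$ is a single-valued $s$ with $s(x)\in S(x)$ for all $x\in\operatorname{dom}S$; one writes $s\in S$. Plant and cost. $x(k+1)=f(x(k),u(k))$ with $x\in\mathbb{R}^{n_x}$, $u\in\mathcal{U}(x)\subseteq\mathbb{R}^{n_u}$, $\mathcal{U}(x)\neq\emptyset$ for every $x$; $\mathcal{W}=\{(x,u):u\in\mathcal{U}(x)\}$. The stage cost is $\ell:\mathbb{R}^{n_x}\times\mathbb{R}^{n_u}\to\mathbb{R}_{\ge0}$. For an admissible infinite input sequence $\mathbf{u}=(u(0),u(1),\dots)$, $J(x,\mathbf{u})=\sum_{k=0}^\infty\ell(x(k),u(k))$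 along the resulting solution from $x(0)=x$. For a feedback law (policy) $h$ with $h\in\mathcal{U}$, $\phi(k,x,h)$ is the closed-loop solution from $x$ and $J(x,h)=\sum_{k=0}^\infty\ell(\phi(k,x,h),h(\phi(k,x,h)))$. $V^\star(x)=\min_{\mathbf{u}}J(x,\mathbf{u})$ and $H^\star(x)=\operatorname{argmin}_{u\in\mathcal{U}(x)}\{\ell(x,u)+V^\star(f(x,u))\}$. Standing assumptions. $\sigma:\mathbb{R}^{n_x}\to\mathbb{R}_{\ge0}$ is continuous, and $h^0\in\mathcal{U}$ is a given initial policy. (SA1) For every $x$ there is an admissible input sequence $\mathbf{u}^\star(x)$ attaining the minimum $V^\star(x)=J(x,\mathbf{u}^\star(x))<+\infty$. (SA2) There exist a continuous $W:\mathbb{R}^{n_x}\to\mathbb{R}_{\ge0}$, $\alpha_W,\chi_W\in\mathcal{K}_\infty$ and $\overline\alpha_W:\mathbb{R}_{\ge0}\to\mathbb{R}_{\ge0}$ continuous, nondecreasing and zero at zero such that for all $(x,u)\in\mathcal{W}$: $W(x)\le\overline\alpha_W(\sigma(x))$ and $W(f(x,u))-W(x)\le-\alpha_W(\sigma(x))+\chi_W(\ell(x,u))$. (SA3) There exists $\overline\alpha_V\in\mathcal{K}_\infty$ with $J(x,h^0)\le\overline\alpha_V(\sigma(x))$ for all $x\in\mathbb{R}^{n_x}$. Policy iteration (PI). $V^0:=J(\cdot,h^0)$. For $i\in\mathbb{Z}_{\ge0}$: $H^{i+1}(x):=\operatorname{argmin}_{u\in\mathcal{U}(x)}\{\ell(x,u)+V^i(f(x,u))\}$;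 an arbitrary selection $h^{i+1}\in H^{i+1}$ is taken; $V^{i+1}:=J(\cdot,h^{i+1})$. Functions. General case: $q_V(s)=2\chi_W(2s)$; $q_W=\tfrac12[\chi_W+(\overline\alpha_W+\mathbb{I})\circ\alpha_W^{-1}(2\chi_W)]^{-1}$ (one half of the inverse function); $\rho_V(s)=\int_0^sq_V(\tau)d\tau$; $\rho_W(s)=\int_0^sq_W(\tau)d\tau$; $\alpha_Y=q_W(\tfrac14\alpha_W)\,\tfrac14\alpha_W$; $\overline\alpha_Y=\rho_V\circ\overline\alpha_V+\rho_W\circ\overline\alpha_W$; $\underline\alpha_Y=\min\{\rho_V\circ\chi_W^{-1}(\tfrac12\alpha_W),\rho_W(\tfrac12\alpha_W)\}$; $\widetilde\alpha_Y=\alpha_Y\circ\overline\alpha_Y^{-1}$; $\widehat\alpha=\overline\alpha_V-\chi_W^{-1}(\max\{0,\alpha_W-\overline\alpha_W\})$. When $\chi_W\le\mathbb{I}$, instead: $\alpha_Y=\alpha_W$, $\overline\alpha_Y=\overline\alpha_V+\overline\alpha_W$, $\underline\alpha_Y=\alpha_W$, $\widetilde\alpha_Y=\alpha_Y\circ\overline\alpha_Y^{-1}$, $\widehat\alpha=\min\{\overline\alpha_V,\overline\alpha_Y-\underline\alpha_Y\}$. When there exist $c_W,a_W,\overline a_V>0$ and $\overline a_W\ge0$ with $\chi_W(s)\le c_Ws$, $\alpha_W(s)\ge a_Ws$, $\overline\alpha_V(s)\le\overline a_Vs$, $\overline\alpha_W(s)\le\overline a_Ws$ for all $s\ge0$,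 instead: $a_Y=a_W$, $\overline a_Y=\overline a_V+\overline a_W$, $\underline a_Y=a_W$, $\widetilde a_Y=a_Y/\overline a_Y$, $\beta(s,k)=\frac{\overline a_Y}{\underline a_Y}(1-\widetilde a_Y)^ks$ and $\widehat\alpha=\min\{\overline a_V,\overline a_Y-\underline a_Y\}\cdot\mathbb{I}$. Convention: $\mathbb{I}-\widetilde\alpha_Y$ is assumed non-decreasing; if it is not, $(\mathbb{I}-\widetilde\alpha_Y)^{(k)}$ in the formula of $\beta$ is replaced by $s\mapsto\max_{\hat s\in[0,s]}(\mathbb{I}-\widetilde\alpha_Y)^{(k)}(\hat s)$.
   Formalization: Positive definiteness of α̃ is claimed only if α̂ takes positive values arbitrarily near 0; in the linear case, with c=max{1,c_W}, ā_Y=c·ā_V+ā_W and α̂=min{ā_V,(ā_Y−a_Y)/c}·I, and β∈KL is claimed only if σ is not identically 0; the original claims fail otherwise. *)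

theory Defs
  imports "HOL-Analysis.Analysis"
begin

section \<open>Comparison functions\<close>

text \<open>Functions on the nonnegative reals are rendered as functions on \<open>real\<close> of which only the
  values on \<open>{0..}\<close> matter.\<close>

definition K_infinity :: "(real \<Rightarrow> real) \<Rightarrow> bool" where
  "K_infinity a \<longleftrightarrow> continuous_on {0..} a \<and> strict_mono_on {0..} a \<and> a 0 = 0
     \<and> \<not> bdd_above (a ` {0..})"

definition class_KL :: "(real \<Rightarrow> nat \<Rightarrow> real) \<Rightarrow> bool" where
  "class_KL b \<longleftrightarrow>
     (\<forall>s\<ge>0. \<forall>k. 0 \<le> b s k) \<and>
     (\<forall>k. mono_on {0..} (\<lambda>s. b s k)) \<and>
     (\<forall>k. ((\<lambda>s. b s k) \<longlongrightarrow> 0) (at_right 0)) \<and>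
     (\<forall>s\<ge>0. antimono (b s)) \<and>
     (\<forall>s\<ge>0. b s \<longlonglongrightarrow> 0)"

text \<open>The running maximum of a difference of comparison functions need not be positive definite,
  even when it is a valid bound: for the plant \<open>f x u = 0\<close>, stage cost \<open>\<bar>x\<bar>\<close>, \<open>\<sigma> x = \<bar>x\<bar>\<close> and \<open>W = 0\<close>,
  with \<open>\<alpha>\<^sub>W\<close>, \<open>\<chi>\<^sub>W\<close> and the bound on the initial cost all equal to the identity, the
  difference \<open>alpha_hat_gen\<close> below is zero.\<close>

definition positive_definite :: "(real \<Rightarrow> real) \<Rightarrow> bool" where
  "positive_definite a \<longleftrightarrow> a 0 = 0 \<and> (\<forall>s>0. 0 < a s)"

text \<open>Inverse of a class-\<open>K_infinity\<close> function, as a function on the nonnegative reals. Negative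
  arguments are sent to the value at 0; they can only arise when \<open>\<lambda>s. s - t s\<close> below
  takes negative values.\<close>

definition kinv :: "(real \<Rightarrow> real) \<Rightarrow> real \<Rightarrow> real" where
  "kinv a s = inv_into {0..} a (max 0 s)"

text \<open>The maximum of \<open>a\<close> over \<open>[0, s]\<close>; it is attained wherever \<open>a\<close> is continuous.\<close>

definition running_max :: "(real \<Rightarrow> real) \<Rightarrow> real \<Rightarrow> real" where
  "running_max a s = (SUP r\<in>{0..s}. a r)"

definition mono_iterate :: "(real \<Rightarrow> real) \<Rightarrow> nat \<Rightarrow> real \<Rightarrow> real" where
  "mono_iterate g k = (if mono_on {0..} g then g ^^ k else running_max (g ^^ k))"

definition beta_fun ::
  "(real \<Rightarrow> real) \<Rightarrow> (real \<Rightarrow> real) \<Rightarrow> (real \<Rightarrow> real) \<Rightarrow> real \<Rightarrow> nat \<Rightarrow> real" where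
  "beta_fun lo t up s k = kinv lo (mono_iterate (\<lambda>r. r - t r) k (up s))"


section \<open>Plant, cost and optimal cost\<close>

primrec solution :: "('x \<Rightarrow> 'u \<Rightarrow> 'x) \<Rightarrow> 'x \<Rightarrow> (nat \<Rightarrow> 'u) \<Rightarrow> nat \<Rightarrow> 'x" where
  "solution f x u 0 = x"
| "solution f x u (Suc k) = f (solution f x u k) (u k)"

definition admissible ::
  "('x \<Rightarrow> 'u \<Rightarrow> 'x) \<Rightarrow> ('x \<Rightarrow> 'u set) \<Rightarrow> 'x \<Rightarrow> (nat \<Rightarrow> 'u) \<Rightarrow> bool" where
  "admissible f U x u \<longleftrightarrow> (\<forall>k. u k \<in> U (solution f x u k))"

text \<open>Costs are extended reals, since the series of nonnegative stage costs may diverge.\<close>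

definition seq_cost ::
  "('x \<Rightarrow> 'u \<Rightarrow> 'x) \<Rightarrow> ('x \<Rightarrow> 'u \<Rightarrow> real) \<Rightarrow> 'x \<Rightarrow> (nat \<Rightarrow> 'u) \<Rightarrow> ereal" where
  "seq_cost f l x u = (\<Sum>k. ereal (l (solution f x u k) (u k)))"

primrec closed_loop :: "('x \<Rightarrow> 'u \<Rightarrow> 'x) \<Rightarrow> nat \<Rightarrow> 'x \<Rightarrow> ('x \<Rightarrow> 'u) \<Rightarrow> 'x" where
  "closed_loop f 0 x h = x"
| "closed_loop f (Suc k) x h = f (closed_loop f k x h) (h (closed_loop f k x h))"

definition policy_cost ::
  "('x \<Rightarrow> 'u \<Rightarrow> 'x) \<Rightarrow> ('x \<Rightarrow> 'u \<Rightarrow> real) \<Rightarrow> 'x \<Rightarrow> ('x \<Rightarrow> 'u) \<Rightarrow> ereal" where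
  "policy_cost f l x h = (\<Sum>k. ereal (l (closed_loop f k x h) (h (closed_loop f k x h))))"

definition opt_cost ::
  "('x \<Rightarrow> 'u \<Rightarrow> 'x) \<Rightarrow> ('x \<Rightarrow> 'u set) \<Rightarrow> ('x \<Rightarrow> 'u \<Rightarrow> real) \<Rightarrow> 'x \<Rightarrow> ereal" where
  "opt_cost f U l x = (INF u\<in>{u. admissible f U x u}. seq_cost f l x u)"

definition greedy_inputs ::
  "('x \<Rightarrow> 'u \<Rightarrow> 'x) \<Rightarrow> ('x \<Rightarrow> 'u set) \<Rightarrow> ('x \<Rightarrow> 'u \<Rightarrow> real) \<Rightarrow> ('x \<Rightarrow> ereal) \<Rightarrow> 'x \<Rightarrow> 'u set" where
  "greedy_inputs f U l V x =
     {u. is_arg_min (\<lambda>v. ereal (l x v) + V (f x v)) (\<lambda>v. v \<in> U x) u}"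

definition opt_inputs ::
  "('x \<Rightarrow> 'u \<Rightarrow> 'x) \<Rightarrow> ('x \<Rightarrow> 'u set) \<Rightarrow> ('x \<Rightarrow> 'u \<Rightarrow> real) \<Rightarrow> 'x \<Rightarrow> 'u set" where
  "opt_inputs f U l = greedy_inputs f U l (opt_cost f U l)"

definition selection :: "('x \<Rightarrow> 'u) \<Rightarrow> ('x \<Rightarrow> 'u set) \<Rightarrow> bool" where
  "selection s S \<longleftrightarrow> (\<forall>x. S x \<noteq> {} \<longrightarrow> s x \<in> S x)"


section \<open>Policy iteration\<close>

text \<open>A run of policy iteration is a sequence of policies \<open>h\<close>; cost and input map at step \<open>i\<close> are
  functions of that run. The input map is meaningful for \<open>i > 0\<close> only.\<close>

definition PI_cost ::
  "('x \<Rightarrow> 'u \<Rightarrow> 'x) \<Rightarrow> ('x \<Rightarrow> 'u \<Rightarrow> real) \<Rightarrow> (nat \<Rightarrow> 'x \<Rightarrow> 'u) \<Rightarrow> nat \<Rightarrow> 'x \<Rightarrow> ereal" where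
  "PI_cost f l h i x = policy_cost f l x (h i)"

definition PI_inputs ::
  "('x \<Rightarrow> 'u \<Rightarrow> 'x) \<Rightarrow> ('x \<Rightarrow> 'u set) \<Rightarrow> ('x \<Rightarrow> 'u \<Rightarrow> real) \<Rightarrow> (nat \<Rightarrow> 'x \<Rightarrow> 'u) \<Rightarrow> nat
     \<Rightarrow> 'x \<Rightarrow> 'u set" where
  "PI_inputs f U l h i = greedy_inputs f U l (PI_cost f l h (i - 1))"


section \<open>Bounding functions, general case\<close>

text \<open>The arguments \<open>ch\<close>, \<open>aW\<close>, \<open>bW\<close>, \<open>bV\<close> are the functions \<open>\<chi>\<^sub>W\<close>, \<open>\<alpha>\<^sub>W\<close> and the upper bounds of
  \<open>W\<close> and of the initial cost in terms of \<open>\<sigma>\<close>.\<close>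

definition q_V :: "(real \<Rightarrow> real) \<Rightarrow> real \<Rightarrow> real" where
  "q_V ch s = 2 * ch (2 * s)"

definition q_W :: "(real \<Rightarrow> real) \<Rightarrow> (real \<Rightarrow> real) \<Rightarrow> (real \<Rightarrow> real) \<Rightarrow> real \<Rightarrow> real" where
  "q_W ch aW bW s =
     1/2 * kinv (\<lambda>r. ch r + (bW (kinv aW (2 * ch r)) + kinv aW (2 * ch r))) s"

definition rho_V :: "(real \<Rightarrow> real) \<Rightarrow> real \<Rightarrow> real" where
  "rho_V ch s = integral {0..s} (q_V ch)"

definition rho_W :: "(real \<Rightarrow> real) \<Rightarrow> (real \<Rightarrow> real) \<Rightarrow> (real \<Rightarrow> real) \<Rightarrow> real \<Rightarrow> real" where
  "rho_W ch aW bW s = integral {0..s} (q_W ch aW bW)"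

definition alpha_Y :: "(real \<Rightarrow> real) \<Rightarrow> (real \<Rightarrow> real) \<Rightarrow> (real \<Rightarrow> real) \<Rightarrow> real \<Rightarrow> real" where
  "alpha_Y ch aW bW s = q_W ch aW bW (1/4 * aW s) * (1/4 * aW s)"

definition alpha_Y_up ::
  "(real \<Rightarrow> real) \<Rightarrow> (real \<Rightarrow> real) \<Rightarrow> (real \<Rightarrow> real) \<Rightarrow> (real \<Rightarrow> real) \<Rightarrow> real \<Rightarrow> real" where
  "alpha_Y_up ch aW bW bV s = rho_V ch (bV s) + rho_W ch aW bW (bW s)"

definition alpha_Y_lo :: "(real \<Rightarrow> real) \<Rightarrow> (real \<Rightarrow> real) \<Rightarrow> (real \<Rightarrow> real) \<Rightarrow> real \<Rightarrow> real" where
  "alpha_Y_lo ch aW bW s =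
     min (rho_V ch (kinv ch (1/2 * aW s))) (rho_W ch aW bW (1/2 * aW s))"

definition alpha_Y_tilde ::
  "(real \<Rightarrow> real) \<Rightarrow> (real \<Rightarrow> real) \<Rightarrow> (real \<Rightarrow> real) \<Rightarrow> (real \<Rightarrow> real) \<Rightarrow> real \<Rightarrow> real" where
  "alpha_Y_tilde ch aW bW bV s = alpha_Y ch aW bW (kinv (alpha_Y_up ch aW bW bV) s)"

definition beta_gen ::
  "(real \<Rightarrow> real) \<Rightarrow> (real \<Rightarrow> real) \<Rightarrow> (real \<Rightarrow> real) \<Rightarrow> (real \<Rightarrow> real) \<Rightarrow> real \<Rightarrow> nat \<Rightarrow> real" where
  "beta_gen ch aW bW bV =
     beta_fun (alpha_Y_lo ch aW bW) (alpha_Y_tilde ch aW bW bV) (alpha_Y_up ch aW bW bV)"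

definition alpha_hat_gen ::
  "(real \<Rightarrow> real) \<Rightarrow> (real \<Rightarrow> real) \<Rightarrow> (real \<Rightarrow> real) \<Rightarrow> (real \<Rightarrow> real) \<Rightarrow> real \<Rightarrow> real" where
  "alpha_hat_gen ch aW bW bV s = bV s - kinv ch (max 0 (aW s - bW s))"


section \<open>Bounding functions when \<open>\<chi>\<^sub>W\<close> is at most the identity\<close>

definition beta_id ::
  "(real \<Rightarrow> real) \<Rightarrow> (real \<Rightarrow> real) \<Rightarrow> (real \<Rightarrow> real) \<Rightarrow> real \<Rightarrow> nat \<Rightarrow> real" where
  "beta_id aW bW bV =
     beta_fun aW (\<lambda>s. aW (kinv (\<lambda>r. bV r + bW r) s)) (\<lambda>s. bV s + bW s)"

definition alpha_hat_id ::
  "(real \<Rightarrow> real) \<Rightarrow> (real \<Rightarrow> real) \<Rightarrow> (real \<Rightarrow> real) \<Rightarrow> real \<Rightarrow> real" where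
  "alpha_hat_id aW bW bV s = min (bV s) (bV s + bW s - aW s)"


section \<open>Bounding functions under linear bounds\<close>

text \<open>Here \<open>c\<close>, \<open>a\<close>, \<open>bW\<close>, \<open>bV\<close> are the slopes. They come from the Lyapunov function
  \<open>max 1 c * V + W\<close>, where \<open>V\<close> is the optimal cost. For \<open>c \<le> 1\<close> the factor \<open>max 1 c\<close> disappears.
  For \<open>c > 1\<close> it cannot be dropped, as the bound on the initial cost would already fail: take the
  plant \<open>f x u = 0\<close>, stage cost
  \<open>(\<bar>x\<bar> + \<bar>u\<bar> / 2) / 4\<close>, \<open>\<sigma> x = \<bar>x\<bar>\<close>, \<open>W = 0\<close>, initial policy \<open>h x = x\<close>, and the
  slopes \<open>c = 4\<close>, \<open>a = 1\<close>, \<open>bW = 0\<close>, \<open>bV = 3/8\<close>.\<close>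

definition a_Y_up :: "real \<Rightarrow> real \<Rightarrow> real \<Rightarrow> real" where
  "a_Y_up c bW bV = max 1 c * bV + bW"

definition beta_lin :: "real \<Rightarrow> real \<Rightarrow> real \<Rightarrow> real \<Rightarrow> real \<Rightarrow> nat \<Rightarrow> real" where
  "beta_lin c a bW bV s k = a_Y_up c bW bV / a * (1 - a / a_Y_up c bW bV) ^ k * s"

definition alpha_hat_lin :: "real \<Rightarrow> real \<Rightarrow> real \<Rightarrow> real \<Rightarrow> real \<Rightarrow> real" where
  "alpha_hat_lin c a bW bV s = min bV ((a_Y_up c bW bV - a) / max 1 c) * s"

end

theory Submission
  imports Defs
begin

text \<open>Exact minimization over the first input turns policy improvement and the Bellman equation into the
  one-step estimate \<open>V (Suc i) x - Vopt x \<le> V i (f x (hs x)) - Vopt (f x (hs x))\<close> for an optimal policy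
  \<open>hs\<close>. So the error after \<open>i\<close> iterations is at most the initial error at the \<open>i\<close>-th point of the
  optimal trajectory, which is controlled by \<open>\<sigma>\<close> there. Along that trajectory \<open>\<sigma>\<close> decays because
  \<open>Y = rho_V Vopt + rho_W W\<close> (in the special cases \<open>Vopt + W\<close> and \<open>max 1 c * Vopt + W\<close>) is a Lyapunov
  function, decreasing by at least \<open>aY (\<sigma> x)\<close> per step. Hence \<open>Y\<close> is dominated by the iterates of the
  running maximum of \<open>g r = r - aY (kinv up r)\<close>.\<close>

section \<open>Class K-infinity functions and their inverses\<close>

text \<open>Neither \<open>Vopt\<close> nor \<open>W\<close> decreases in terms of
  \<open>\<sigma>\<close> by itself: \<open>Vopt\<close> falls by the stage cost \<open>c\<close>,
  which may vanish where \<open>\<sigma>\<close> does not, and \<open>W\<close> may grow when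
  \<open>c\<close> is large. In a sum the fall of \<open>Vopt\<close> has to pay for the growth of
  \<open>W\<close>, but \<open>ch c\<close> is in general not bounded by a multiple of
  \<open>c\<close>. The primitives \<open>rho_V\<close> and \<open>rho_W\<close> repair this: the
  slope of \<open>rho_V\<close> makes its fall at least \<open>c * ch c\<close>, and the slope of
  \<open>rho_W\<close> is so small that, when \<open>W\<close> can grow, it costs at most half of
  that.

  A second obstacle is that \<open>g\<close> need be neither monotone nor nonnegative, so an
  inequality \<open>y (Suc k) \<le> g (y k)\<close> cannot be iterated. Its running maximum is
  monotone, hence can be; that this agrees with the maximum of the \<open>k\<close>-th iterate of
  \<open>g\<close> is a separate fact.

  The bound on the initial error comes from nonnegativity of \<open>W\<close> after one step: this
  bounds \<open>ch (Vopt x)\<close> below by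
  \<open>aW (\<sigma> x) - bW (\<sigma> x)\<close>.\<close>

lemma K_infinityI:
  assumes "continuous_on {0..} a" "strict_mono_on {0..} a" "a 0 = 0" "\<And>M. \<exists>s\<ge>0. M < a s"
  shows "K_infinity a"
  unfolding K_infinity_def
proof (intro conjI assms notI)
  assume "bdd_above (a ` {0..})"
  then obtain M where "\<And>s. s \<ge> 0 \<Longrightarrow> a s \<le> M"
    by (auto simp: bdd_above_def)
  with assms(4)[of M] show False
    by (meson not_le)
qed

context
  fixes a :: "real \<Rightarrow> real"
  assumes K: "K_infinity a"
begin

lemma K_infinity_cont: "continuous_on {0..} a"
  and K_infinity_zero: "a 0 = 0"
  using K by (auto simp: K_infinity_def)

lemma K_infinity_less_iff: "0 \<le> r \<Longrightarrow> 0 \<le> s \<Longrightarrow> a r < a s \<longleftrightarrow> r < s"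
  using K strict_mono_on_less[of "{0..}" a r s] by (auto simp: K_infinity_def)

lemma K_infinity_le_iff: "0 \<le> r \<Longrightarrow> 0 \<le> s \<Longrightarrow> a r \<le> a s \<longleftrightarrow> r \<le> s"
  using K_infinity_less_iff[of s r] by (meson not_le)

lemma K_infinity_nonneg: "0 \<le> s \<Longrightarrow> 0 \<le> a s"
  using K_infinity_le_iff[of 0 s] K_infinity_zero by simp

lemma K_infinity_pos: "0 < s \<Longrightarrow> 0 < a s"
  using K_infinity_less_iff[of 0 s] K_infinity_zero by simp

lemma K_infinity_unbounded: "\<exists>s\<ge>0. M < a s"
proof (rule ccontr)
  assume "\<not> (\<exists>s\<ge>0. M < a s)"
  then have "bdd_above (a ` {0..})"
    by (intro bdd_aboveI[where M = M]) (auto simp: not_less)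
  with K show False by (simp add: K_infinity_def)
qed

lemma K_infinity_surj:
  assumes "0 \<le> s" shows "\<exists>r\<ge>0. a r = s"
proof -
  obtain r where "0 \<le> r" "s < a r"
    using K_infinity_unbounded by blast
  then have "\<exists>x\<ge>0. x \<le> r \<and> a x = s"
    using assms K_infinity_zero by (intro IVT') (auto intro: continuous_on_subset[OF K_infinity_cont])
  then show ?thesis by blast
qed

lemma kinv_left: "0 \<le> r \<Longrightarrow> kinv a (a r) = r"
  unfolding kinv_def using K_infinity_nonneg[of r] K
  by (simp add: max_def inv_into_f_f K_infinity_def strict_mono_on_imp_inj_on)

lemma kinv_nonneg: "0 \<le> kinv a s"
proof -
  obtain r where "0 \<le> r" "a r = max 0 s"
    using K_infinity_surj[of "max 0 s"] by auto
  then show ?thesis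
    using kinv_left[of r] by (simp add: kinv_def)
qed

lemma kinv_right: "0 \<le> s \<Longrightarrow> a (kinv a s) = s"
  using K_infinity_surj[of s] kinv_left by metis

lemma kinv_nonpos: "s \<le> 0 \<Longrightarrow> kinv a s = 0"
  using kinv_left[of 0] K_infinity_zero by (simp add: kinv_def max_def)

lemma kinv_less_iff: "0 \<le> r \<Longrightarrow> 0 \<le> s \<Longrightarrow> kinv a r < kinv a s \<longleftrightarrow> r < s"
  by (metis K_infinity_less_iff kinv_nonneg kinv_right)

lemma kinv_pos: "0 < s \<Longrightarrow> 0 < kinv a s"
  using kinv_less_iff[of 0 s] kinv_nonpos[of 0] by simp

lemma kinv_mono: "r \<le> s \<Longrightarrow> kinv a r \<le> kinv a s"
  using kinv_less_iff[of s r] kinv_nonneg[of s] kinv_nonpos[of r] by (metis leI le_less_trans less_imp_le not_le)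

lemma kinv_le_iff: "0 \<le> r \<Longrightarrow> 0 \<le> s \<Longrightarrow> kinv a s \<le> r \<longleftrightarrow> s \<le> a r"
  by (metis K_infinity_le_iff kinv_nonneg kinv_right)

lemma le_kinv_iff: "0 \<le> r \<Longrightarrow> 0 \<le> s \<Longrightarrow> r \<le> kinv a s \<longleftrightarrow> a r \<le> s"
  by (metis K_infinity_le_iff kinv_nonneg kinv_right)

text \<open>A monotone map with open range is continuous. The range of \<open>kinv a\<close> is not
  open, so the identity is glued on below 0 to get a monotone surjection \<open>b\<close> of the
  line; \<open>kinv a\<close> is \<open>b\<close> after \<open>max 0\<close>.\<close>

lemma continuous_on_kinv_UNIV: "continuous_on UNIV (kinv a)"
proof -
  define b where "b s = (if s < 0 then s else kinv a s)" for s
  have "range b = UNIV"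
  proof (intro set_eqI iffI UNIV_I)
    fix r :: real
    show "r \<in> range b"
    proof (cases "r < 0")
      case True
      then have "r = b r" by (simp add: b_def)
      then show ?thesis by blast
    next
      case False
      then have "r = b (a r)"
        using K_infinity_nonneg[of r] kinv_left[of r] by (auto simp: b_def)
      then show ?thesis by blast
    qed
  qed
  moreover have "b r \<le> b s" if "r \<le> s" for r s
    using that kinv_mono[of r s] kinv_nonneg[of s] by (auto simp: b_def)
  ultimately have "continuous_on UNIV b"
    by (intro continuous_onI_mono) auto
  then have "continuous_on UNIV (\<lambda>s. b (max 0 s))"
    by (intro continuous_on_compose2[of UNIV b UNIV "\<lambda>s. max 0 s"] continuous_intros) auto
  moreover have "b (max 0 s) = kinv a s" for s
    by (simp add: b_def kinv_def)
  ultimately show ?thesis by simp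
qed

lemma continuous_on_kinv: 
  "continuous_on S g \<Longrightarrow> continuous_on S (\<lambda>x. kinv a (g x))"
  by (rule continuous_on_compose2[OF continuous_on_kinv_UNIV]) auto

lemma continuous_on_K_infinity:
  "continuous_on S g \<Longrightarrow> (\<And>x. x \<in> S \<Longrightarrow> 0 \<le> g x) \<Longrightarrow> continuous_on S (\<lambda>x. a (g x))"
  by (rule continuous_on_compose2[OF K_infinity_cont]) auto

lemma K_infinity_kinv: "K_infinity (kinv a)"
proof (rule K_infinityI)
  fix M :: real
  have "M < kinv a (a (\<bar>M\<bar> + 1))"
    using kinv_left[of "\<bar>M\<bar> + 1"] by linarith
  moreover have "0 \<le> a (\<bar>M\<bar> + 1)"
    by (rule K_infinity_nonneg) simp
  ultimately show "\<exists>s\<ge>0. M < kinv a s"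
    by blast
qed (auto intro!: continuous_on_kinv strict_mono_onI kinv_nonpos simp: kinv_less_iff)

end

lemma K_infinity_compose:
  assumes "K_infinity a" "K_infinity b"
  shows "K_infinity (\<lambda>s. a (b s))"
proof (rule K_infinityI)
  show "continuous_on {0..} (\<lambda>s. a (b s))"
    using assms by (auto intro: continuous_on_K_infinity[OF _ K_infinity_cont] K_infinity_nonneg)
  show "strict_mono_on {0..} (\<lambda>s. a (b s))"
    using assms by (auto intro!: strict_mono_onI simp: K_infinity_less_iff K_infinity_nonneg)
  show "a (b 0) = 0"
    using assms by (simp add: K_infinity_zero)
  fix M
  obtain r where "0 \<le> r" "M < a r"
    using K_infinity_unbounded[OF assms(1)] by blast
  moreover obtain s where "0 \<le> s" "b s = r"
    using K_infinity_surj[OF assms(2)] \<open>0 \<le> r\<close> by blast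
  ultimately show "\<exists>s\<ge>0. M < a (b s)" by blast
qed

text \<open>Strictness and unboundedness come from \<open>a\<close> alone, since \<open>b\<close>
  will be built from \<open>bW\<close>, which is only nondecreasing and may be zero.\<close>

lemma K_infinity_add:
  assumes "K_infinity a" "continuous_on {0..} b" "mono_on {0..} b" "b 0 = 0"
  shows "K_infinity (\<lambda>s. a s + b s)"
proof (rule K_infinityI)
  show "continuous_on {0..} (\<lambda>s. a s + b s)"
    using assms by (intro continuous_on_add K_infinity_cont[OF assms(1)])
  show "strict_mono_on {0..} (\<lambda>s. a s + b s)"
    using assms(1,3)
    by (auto intro!: strict_mono_onI add_less_le_mono simp: K_infinity_less_iff mono_on_def)
  show "a 0 + b 0 = 0"
    using assms by (simp add: K_infinity_zero)
  fix M
  obtain s where s: "0 \<le> s" "M < a s"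
    using K_infinity_unbounded[OF assms(1)] by blast
  moreover have "0 \<le> b s"
    using mono_onD[OF assms(3), of 0 s] s assms(4) by simp
  ultimately have "M < a s + b s" by simp
  then show "\<exists>s\<ge>0. M < a s + b s"
    using s by blast
qed

lemma K_infinity_mono_on: "K_infinity a \<Longrightarrow> mono_on {0..} a"
  by (auto intro!: mono_onI simp: K_infinity_le_iff)

lemma K_infinity_scale:
  assumes "K_infinity a" "0 < c"
  shows "K_infinity (\<lambda>s. c * a s)"
proof (rule K_infinityI)
  fix M
  obtain s where "0 \<le> s" "M / c < a s"
    using K_infinity_unbounded[OF assms(1)] by blast
  then show "\<exists>s\<ge>0. M < c * a s"
    using assms(2) by (auto simp: field_simps)
next
  show "continuous_on {0..} (\<lambda>s. c * a s)"
    using assms by (intro continuous_on_mult_left K_infinity_cont)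
qed (use assms in \<open>auto intro!: strict_mono_onI simp: K_infinity_less_iff K_infinity_zero\<close>)

lemma min_strict_mono:
  fixes p q r s :: real
  shows "p < q \<Longrightarrow> r < s \<Longrightarrow> min p r < min q s"
  by linarith

lemma K_infinity_min:
  assumes "K_infinity a" "K_infinity b"
  shows "K_infinity (\<lambda>s. min (a s) (b s))"
proof (rule K_infinityI)
  show "continuous_on {0..} (\<lambda>s. min (a s) (b s))"
    using assms by (intro continuous_on_min K_infinity_cont)
  show "strict_mono_on {0..} (\<lambda>s. min (a s) (b s))"
    using assms by (auto intro!: strict_mono_onI min_strict_mono simp: K_infinity_less_iff)
  show "min (a 0) (b 0) = 0"
    using assms by (simp add: K_infinity_zero)
  fix M
  obtain r s where rs: "0 \<le> r" "M < a r" "0 \<le> s" "M < b s"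
    using assms K_infinity_unbounded by metis
  then have "a r \<le> a (max r s)" "b s \<le> b (max r s)"
    using assms by (auto simp: K_infinity_le_iff)
  with rs have "M < min (a (max r s)) (b (max r s))" by simp
  with rs show "\<exists>s\<ge>0. M < min (a s) (b s)"
    by (intro exI[of _ "max r s"]) auto
qed

section \<open>Running maxima and their iterates\<close>

lemma running_max_bdd:
  fixes a :: "real \<Rightarrow> real"
  assumes "continuous_on {0..} a"
  shows "bdd_above (a ` {0..s})"
  by (intro bounded_imp_bdd_above compact_imp_bounded compact_continuous_image
      continuous_on_subset[OF assms]) auto

context
  fixes a :: "real \<Rightarrow> real"
  assumes cont: "continuous_on {0..} a"
begin

lemma running_max_upper: "0 \<le> r \<Longrightarrow> r \<le> s \<Longrightarrow> a r \<le> running_max a s"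
  unfolding running_max_def by (rule cSUP_upper) (auto intro: running_max_bdd[OF cont])

lemma running_max_attained:
  assumes "0 \<le> s" obtains r where "0 \<le> r" "r \<le> s" "running_max a s = a r"
proof -
  obtain r where r: "r \<in> {0..s}" "\<And>q. q \<in> {0..s} \<Longrightarrow> a q \<le> a r"
    using continuous_attains_sup[of "{0..s}" a] continuous_on_subset[OF cont, of "{0..s}"] assms
    by auto
  then have "running_max a s = a r"
    unfolding running_max_def by (intro cSup_eq_maximum) auto
  with r that show thesis by auto
qed

lemma running_max_mono: "0 \<le> r \<Longrightarrow> r \<le> s \<Longrightarrow> running_max a r \<le> running_max a s"
  by (metis order_trans running_max_attained running_max_upper)

lemma mono_on_running_max: "mono_on {0..} (running_max a)"
  by (auto intro!: mono_onI running_max_mono)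

lemma running_max_positive_definite:
  assumes "a 0 = 0" "\<exists>\<^sub>F s in at_right 0. 0 < a s"
  shows "positive_definite (running_max a)"
  unfolding positive_definite_def
proof (intro conjI allI impI)
  show "running_max a 0 = 0"
    using assms(1) by (simp add: running_max_def)
  fix s :: real
  assume "0 < s"
  then have "eventually (\<lambda>r. r \<in> {0<..<s}) (at_right 0)"
    by (rule eventually_at_right_real)
  with assms(2) have "\<exists>\<^sub>F r in at_right 0. r \<in> {0<..<s} \<and> 0 < a r"
    by (rule frequently_eventually_conj)
  then obtain r where "0 < a r" "r \<in> {0<..<s}"
    using frequently_ex by blast
  then show "0 < running_max a s"
    using running_max_upper[of r s] by auto
qed

text \<open>If the maximum grows between two points near \<open>s\<close>, the new maximizer lies
  between them, where \<open>a\<close> differs little from \<open>a s\<close>; so the growth is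
  small too.\<close>

lemma continuous_on_running_max: "continuous_on {0..} (running_max a)"
  unfolding continuous_on_iff
proof (intro ballI allI impI)
  fix s e :: real
  assume s: "s \<in> {0..}" and "0 < e"
  then have "\<exists>d>0. \<forall>r\<in>{0..}. dist r s < d \<longrightarrow> dist (a r) (a s) < e/2"
    using cont unfolding continuous_on_iff by (meson half_gt_zero)
  then obtain d where d: "0 < d" "\<And>r. 0 \<le> r \<Longrightarrow> \<bar>r - s\<bar> < d \<Longrightarrow> \<bar>a r - a s\<bar> < e/2"
    by (auto simp: dist_real_def)
  have below: "running_max a r - e < running_max a q"
    if "0 \<le> q" "q \<le> r" "\<bar>q - s\<bar> < d" "\<bar>r - s\<bar> < d" for q r
  proof -
    obtain p where p: "0 \<le> p" "p \<le> r" "running_max a r = a p"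
      using running_max_attained[of r] \<open>0 \<le> q\<close> \<open>q \<le> r\<close> by auto
    show ?thesis
    proof (cases "p \<le> q")
      case True
      then show ?thesis using running_max_upper[of p q] p \<open>0 < e\<close> by simp
    next
      case False
      then have "\<bar>a p - a s\<bar> < e/2" "\<bar>a q - a s\<bar> < e/2"
        using that p by (intro d(2); linarith)+
      then show ?thesis
        using running_max_upper[of q q] p that by linarith
    qed
  qed
  have "\<bar>running_max a r - running_max a s\<bar> < e" if "0 \<le> r" "\<bar>r - s\<bar> < d" for r
  proof (cases "r \<le> s")
    case True
    then show ?thesis
      using below[of r s] running_max_mono[of r s] that d(1) by auto
  next
    case False
    then show ?thesis
      using below[of s r] running_max_mono[of s r] that d(1) s by auto
  qed
  with d(1) show "\<exists>d>0. \<forall>r\<in>{0..}. dist r s < d \<longrightarrow> dist (running_max a r) (running_max a s) < e"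
    by (auto simp: dist_real_def)
qed

end

lemma funpow_nonneg:
  fixes G :: "real \<Rightarrow> real"
  assumes "\<And>s. 0 \<le> s \<Longrightarrow> 0 \<le> G s" "0 \<le> s"
  shows "0 \<le> (G ^^ k) s"
  by (induction k) (use assms in auto)

lemma continuous_on_funpow:
  fixes g :: "'a::topological_space \<Rightarrow> 'a"
  assumes "continuous_on S g" "g ` S \<subseteq> S"
  shows "continuous_on S (g ^^ k) \<and> (g ^^ k) ` S \<subseteq> S"
proof (induction k)
  case (Suc k)
  have "continuous_on S (\<lambda>x. g ((g ^^ k) x))"
    using Suc assms by (intro continuous_on_compose2[OF assms(1)]) auto
  moreover have "(g ^^ Suc k) ` S \<subseteq> S"
    using Suc assms(2) by auto
  ultimately show ?case by (simp add: o_def)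
qed (auto intro: continuous_intros simp: id_def)

text \<open>The iterates decrease to a limit, which by continuity is a fixed point, and
  \<open>G s < s\<close> rules out positive fixed points.\<close>

lemma funpow_tendsto_zero:
  fixes G :: "real \<Rightarrow> real"
  assumes cont: "continuous_on {0..} G" and nonneg: "\<And>s. 0 \<le> s \<Longrightarrow> 0 \<le> G s"
    and less: "\<And>s. 0 < s \<Longrightarrow> G s < s" and "0 \<le> s"
  shows "(\<lambda>k. (G ^^ k) s) \<longlonglongrightarrow> 0"
proof -
  have pos: "0 \<le> (G ^^ k) s" for k
    using nonneg \<open>0 \<le> s\<close> by (rule funpow_nonneg)
  \<comment> \<open>The strict inequality is assumed for positive arguments only; its limit at 0 is
    needed for iterates that reach 0.\<close>
  have "G 0 \<le> 0"
  proof (rule tendsto_le[of "at_right (0::real)"])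
    show "(G \<longlongrightarrow> G 0) (at_right 0)"
      using cont by (auto simp: continuous_on intro: tendsto_within_subset)
    show "eventually (\<lambda>r. G r \<le> r) (at_right 0)"
      using eventually_at_right_less by (rule eventually_mono) (simp add: less less_imp_le)
  qed (auto intro!: tendsto_eq_intros)
  then have le: "G r \<le> r" if "0 \<le> r" for r
    using less[of r] that by (cases "r = 0") auto
  have "decseq (\<lambda>k. (G ^^ k) s)"
    using le pos by (auto intro!: decseq_SucI)
  then obtain L where L: "(\<lambda>k. (G ^^ k) s) \<longlonglongrightarrow> L" "\<And>k. L \<le> (G ^^ k) s"
    using decseq_convergent[of _ 0] pos by metis
  have "0 \<le> L"
    using L(1) pos by (intro LIMSEQ_le_const) auto
  have "(\<lambda>k. G ((G ^^ k) s)) \<longlonglongrightarrow> G L"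
    using cont pos L(1) \<open>0 \<le> L\<close>
    by (intro continuous_on_tendsto_compose[of "{0..}" G]) auto
  moreover have "(\<lambda>k. G ((G ^^ k) s)) \<longlonglongrightarrow> L"
    using LIMSEQ_Suc[OF L(1)] by simp
  ultimately have "G L = L"
    using LIMSEQ_unique by blast
  then have "L = 0"
    using less[of L] \<open>0 \<le> L\<close> by (cases "0 < L") auto
  with L show ?thesis by simp
qed

context
  fixes g :: "real \<Rightarrow> real"
  assumes cont: "continuous_on UNIV g" and zero: "g 0 = 0" and le_id: "\<And>r. g r \<le> r"
begin

lemma funpow_zero: "(g ^^ k) 0 = 0"
  by (induction k) (auto simp: zero)

lemma funpow_cont: "continuous_on S (g ^^ k)"
  using continuous_on_funpow[OF cont] continuous_on_subset by blast

lemma running_max_funpow_nonneg: "0 \<le> s \<Longrightarrow> 0 \<le> running_max (g ^^ k) s"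
  using running_max_upper[of "g ^^ k" 0 s] funpow_cont funpow_zero by simp

text \<open>By the intermediate value theorem, the nonnegative values of an iterate on an interval
  starting at 0 fill the interval up to the running maximum; negative values stay negative.
  This makes the two cases in \<open>mono_iterate\<close> coincide.\<close>

lemma running_max_funpow: "0 \<le> s \<Longrightarrow> running_max (g ^^ k) s = (running_max g ^^ k) s"
proof (induction k)
  case 0
  then show ?case
    unfolding running_max_def by (auto intro!: cSup_eq_maximum)
next
  case (Suc k)
  define M where "M = running_max (g ^^ k) s"
  have "0 \<le> M"
    unfolding M_def using Suc.prems by (rule running_max_funpow_nonneg)
  have contg: "continuous_on {0..} g" and contk: "continuous_on {0..} (g ^^ k)"
    and contSk: "continuous_on {0..} (g ^^ Suc k)"
    using cont continuous_on_subset funpow_cont by blast+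
  have "running_max (g ^^ Suc k) s = running_max g M"
  proof (rule antisym)
    obtain r where r: "0 \<le> r" "r \<le> s" "running_max (g ^^ Suc k) s = g ((g ^^ k) r)"
      using running_max_attained[OF contSk Suc.prems] by auto
    have "(g ^^ k) r \<le> M"
      unfolding M_def using running_max_upper[OF contk] r by simp
    moreover have "0 \<le> running_max g M"
      using running_max_upper[OF contg, of 0 M] zero \<open>0 \<le> M\<close> by simp
    ultimately show "running_max (g ^^ Suc k) s \<le> running_max g M"
      using running_max_upper[OF contg, of "(g ^^ k) r" M] le_id[of "(g ^^ k) r"] r by linarith
  next
    obtain q where q: "0 \<le> q" "q \<le> M" "running_max g M = g q"
      using running_max_attained[OF contg \<open>0 \<le> M\<close>] by auto
    obtain p where p: "0 \<le> p" "p \<le> s" "M = (g ^^ k) p"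
      using running_max_attained[OF contk Suc.prems] M_def by auto
    have "\<exists>r\<ge>0. r \<le> p \<and> (g ^^ k) r = q"
      using q p by (intro IVT') (auto simp: funpow_zero intro: funpow_cont)
    then obtain r where "0 \<le> r" "r \<le> s" "(g ^^ k) r = q"
      using p by auto
    then show "running_max g M \<le> running_max (g ^^ Suc k) s"
      using running_max_upper[OF contSk, of r s] q by simp
  qed
  then show ?case
    unfolding \<open>running_max (g ^^ Suc k) s = running_max g M\<close> by (simp add: M_def Suc)
qed

text \<open>If \<open>g\<close> is nondecreasing, so are its iterates, and each attains its maximum
  over \<open>{0..s}\<close> at \<open>s\<close>. Later arguments can thus use the monotone map
  \<open>running_max g\<close> in both cases.\<close>

lemma mono_iterate_eq: "0 \<le> s \<Longrightarrow> mono_iterate g k s = (running_max g ^^ k) s"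
proof (cases "mono_on {0..} g")
  case True
  assume "0 \<le> s"
  have "running_max (g ^^ k) s = (g ^^ k) s"
  proof -
    have nonneg: "0 \<le> g r" if "0 \<le> r" for r
      using mono_onD[OF True, of 0 r] zero that by simp
    have "mono_on {0..} (g ^^ k)"
    proof (induction k)
      case (Suc k)
      then show ?case
        by (auto intro!: mono_onI mono_onD[OF True] funpow_nonneg nonneg dest: mono_onD)
    qed (auto intro: mono_onI)
    then show ?thesis
      using \<open>0 \<le> s\<close> unfolding running_max_def
      by (intro cSup_eq_maximum) (auto dest: mono_onD)
  qed
  with True \<open>0 \<le> s\<close> show ?thesis
    by (simp add: mono_iterate_def running_max_funpow)
qed (simp add: mono_iterate_def running_max_funpow)

end

section \<open>Comparison functions along decreasing sequences\<close>

text \<open>\<open>lo\<close> and \<open>up\<close> enclose a Lyapunov function in terms of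
  \<open>\<sigma>\<close>; \<open>aY\<close> is its guaranteed decrease per step.\<close>

locale comparison_triple =
  fixes lo up aY :: "real \<Rightarrow> real"
  assumes lo_K: "K_infinity lo" and up_K: "K_infinity up"
    and aY_cont: "continuous_on {0..} aY" and aY_mono: "mono_on {0..} aY"
    and aY_zero: "aY 0 = 0" and aY_pos: "\<And>s. 0 < s \<Longrightarrow> 0 < aY s"
begin

text \<open>On negative arguments \<open>kinv up\<close> is 0 and \<open>g\<close> is the identity,
  so iterating stays harmless once \<open>g\<close> has produced a negative value.\<close>

definition "g r = r - aY (kinv up r)"

lemma g_cont: "continuous_on S g"
proof -
  have "continuous_on UNIV g"
    unfolding g_def
    by (intro continuous_on_diff continuous_on_id continuous_on_compose2[OF aY_cont]
        continuous_on_kinv_UNIV[OF up_K]) (auto simp: kinv_nonneg[OF up_K])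
  then show ?thesis
    using continuous_on_subset by blast
qed

lemma g_zero: "g 0 = 0"
  by (simp add: g_def kinv_nonpos[OF up_K] aY_zero)

lemma g_less: "0 < r \<Longrightarrow> g r < r"
  by (simp add: g_def aY_pos kinv_pos[OF up_K])

lemma g_le: "g r \<le> r"
  using g_less[of r] by (cases "0 < r") (auto simp: g_def kinv_nonpos[OF up_K] aY_zero)

abbreviation "G \<equiv> running_max g"

lemma G_nonneg: "0 \<le> s \<Longrightarrow> 0 \<le> G s"
  using running_max_upper[OF g_cont, of 0 s] g_zero by simp

lemma G_less:
  assumes "0 < s" shows "G s < s"
proof -
  obtain r where r: "0 \<le> r" "r \<le> s" "G s = g r"
    using running_max_attained[OF g_cont, of s] assms by auto
  then show ?thesis
    using g_less[of r] assms g_zero by (cases "r = 0") auto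
qed

lemma G_zero: "G 0 = 0"
  by (simp add: running_max_def g_zero)

lemma G_le: "0 \<le> s \<Longrightarrow> G s \<le> s"
  using G_less[of s] G_zero by (cases "s = 0") auto

lemma G_funpow_cont: "continuous_on {0..} (G ^^ k)"
  using continuous_on_funpow[OF continuous_on_running_max[OF g_cont], of k] G_nonneg by auto

lemma G_funpow_nonneg: "0 \<le> s \<Longrightarrow> 0 \<le> (G ^^ k) s"
  by (rule funpow_nonneg[OF G_nonneg])

lemma G_funpow_mono: "0 \<le> r \<Longrightarrow> r \<le> s \<Longrightarrow> (G ^^ k) r \<le> (G ^^ k) s"
  by (induction k) (auto intro!: running_max_mono[OF g_cont] G_funpow_nonneg)

lemma beta_fun_eq:
  "0 \<le> s \<Longrightarrow> beta_fun lo (\<lambda>s. aY (kinv up s)) up s k = kinv lo ((G ^^ k) (up s))"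
  unfolding beta_fun_def g_def[abs_def, symmetric]
  by (simp add: mono_iterate_eq[OF g_cont g_zero g_le] K_infinity_nonneg[OF up_K])

text \<open>\<open>G\<close> is continuous, nondecreasing and strictly below the identity on
  positive arguments, so its iterates decrease to 0; \<open>kinv lo\<close> is monotone and
  continuous and preserves this.\<close>

lemma class_KL_beta_fun: "class_KL (beta_fun lo (\<lambda>s. aY (kinv up s)) up)"
  unfolding class_KL_def
proof (intro conjI allI impI)
  let ?b = "beta_fun lo (\<lambda>s. aY (kinv up s)) up"
  note up_nonneg = K_infinity_nonneg[OF up_K]
  fix k
  show "mono_on {0..} (\<lambda>s. ?b s k)"
    by (auto intro!: mono_onI kinv_mono[OF lo_K] G_funpow_mono
        simp: beta_fun_eq up_nonneg K_infinity_le_iff[OF up_K])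
  have "continuous_on {0..} (\<lambda>s. kinv lo ((G ^^ k) (up s)))"
    by (intro continuous_on_kinv[OF lo_K] continuous_on_compose2[OF G_funpow_cont]
        K_infinity_cont[OF up_K]) (auto simp: up_nonneg)
  then have "((\<lambda>s. kinv lo ((G ^^ k) (up s))) \<longlongrightarrow> kinv lo ((G ^^ k) (up 0))) (at_right 0)"
    by (auto simp: continuous_on intro: tendsto_within_subset)
  moreover have "(G ^^ k) 0 = 0"
    by (induction k) (auto simp: G_zero)
  moreover have "eventually (\<lambda>s. kinv lo ((G ^^ k) (up s)) = ?b s k) (at_right 0)"
    using eventually_at_right_less by (rule eventually_mono) (simp add: beta_fun_eq)
  ultimately show "((\<lambda>s. ?b s k) \<longlongrightarrow> 0) (at_right 0)"
    by (simp add: K_infinity_zero[OF up_K] kinv_nonpos[OF lo_K] Lim_transform_eventually)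
next
  fix s :: real
  assume "0 \<le> s"
  let ?b = "beta_fun lo (\<lambda>s. aY (kinv up s)) up"
  have up: "0 \<le> up s"
    using K_infinity_nonneg[OF up_K \<open>0 \<le> s\<close>] .
  show "0 \<le> ?b s k" for k
    using \<open>0 \<le> s\<close> by (simp add: beta_fun_eq kinv_nonneg[OF lo_K])
  show "antimono (?b s)"
    using \<open>0 \<le> s\<close> up
    by (intro decseq_SucI) (auto simp: beta_fun_eq intro!: kinv_mono[OF lo_K] G_le G_funpow_nonneg)
  have "(\<lambda>k. (G ^^ k) (up s)) \<longlonglongrightarrow> 0"
    by (rule funpow_tendsto_zero[OF continuous_on_running_max[OF g_cont] G_nonneg G_less up])
  then have "(\<lambda>k. kinv lo ((G ^^ k) (up s))) \<longlonglongrightarrow> kinv lo 0"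
    by (intro continuous_on_tendsto_compose[OF continuous_on_kinv_UNIV[OF lo_K]]) auto
  moreover have "?b s = (\<lambda>k. kinv lo ((G ^^ k) (up s)))"
    using \<open>0 \<le> s\<close> by (auto simp: beta_fun_eq)
  ultimately show "?b s \<longlonglongrightarrow> 0"
    by (simp add: kinv_nonpos[OF lo_K])
qed

text \<open>The upper bound gives \<open>kinv up (y k) \<le> s k\<close>, which turns the decrease
  in terms of \<open>s k\<close> into \<open>y (Suc k) \<le> g (y k) \<le> G (y k)\<close>.
  Monotonicity of \<open>G\<close> lets this be iterated, and \<open>kinv lo\<close> returns to
  \<open>s k\<close>.\<close>

lemma beta_fun_bound:
  fixes y s :: "nat \<Rightarrow> real"
  assumes nonneg: "\<And>k. 0 \<le> s k" and lo: "\<And>k. lo (s k) \<le> y k" and up: "\<And>k. y k \<le> up (s k)"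
    and decrease: "\<And>k. y (Suc k) \<le> y k - aY (s k)"
  shows "s k \<le> beta_fun lo (\<lambda>s. aY (kinv up s)) up (s 0) k"
proof -
  have y: "0 \<le> y k" for k
    using lo[of k] K_infinity_nonneg[OF lo_K nonneg[of k]] by simp
  have "y (Suc k) \<le> G (y k)" for k
  proof -
    have "kinv up (y k) \<le> s k"
      using up y nonneg by (simp add: kinv_le_iff[OF up_K])
    then have "aY (kinv up (y k)) \<le> aY (s k)"
      by (intro mono_onD[OF aY_mono]) (auto simp: kinv_nonneg[OF up_K] nonneg)
    then have "y (Suc k) \<le> g (y k)"
      using decrease[of k] by (simp add: g_def)
    also have "\<dots> \<le> G (y k)"
      using running_max_upper[OF g_cont] y by simp
    finally show ?thesis .
  qed
  then have "y k \<le> (G ^^ k) (y 0)"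
  proof (induction k)
    case (Suc k)
    then show ?case
      using running_max_mono[OF g_cont y Suc.IH] by (simp add: order_trans[OF Suc.prems])
  qed simp
  also have "\<dots> \<le> (G ^^ k) (up (s 0))"
    by (rule G_funpow_mono[OF y up])
  finally have "lo (s k) \<le> (G ^^ k) (up (s 0))"
    using lo[of k] by simp
  then show ?thesis
    using nonneg K_infinity_nonneg[OF up_K nonneg[of 0]]
    by (simp add: beta_fun_eq le_kinv_iff[OF lo_K] G_funpow_nonneg)
qed

end

section \<open>Integrals of comparison functions\<close>

lemma continuous_on_K_infinity_subset:
  assumes "K_infinity a" "S \<subseteq> {0..}"
  shows "continuous_on S a"
  using continuous_on_subset[OF K_infinity_cont[OF assms(1)] assms(2)] .

context
  fixes q :: "real \<Rightarrow> real"
  assumes K: "K_infinity q"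
begin

lemma K_infinity_integrable: "0 \<le> r \<Longrightarrow> q integrable_on {r..s}"
  by (intro integrable_continuous_real continuous_on_K_infinity_subset[OF K]) auto

lemma integral_diff_eq:
  "0 \<le> r \<Longrightarrow> r \<le> s \<Longrightarrow> integral {0..s} q - integral {0..r} q = integral {r..s} q"
  using Henstock_Kurzweil_Integration.integral_combine[where a = 0 and c = r and b = s and f = q] K_infinity_integrable[of 0 s] by simp

lemma integral_diff_ge:
  assumes "0 \<le> r" "r \<le> s"
  shows "q r * (s - r) \<le> integral {0..s} q - integral {0..r} q"
proof -
  have "integral {r..s} (\<lambda>_. q r) \<le> integral {r..s} q"
    using assms by (intro integral_le K_infinity_integrable) (auto simp: K_infinity_le_iff[OF K])
  then show ?thesis
    using assms by (simp add: integral_diff_eq mult.commute)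
qed

text \<open>The primitive of an increasing function is convex, so it lies above its tangent at
  \<open>s\<close>. This works for either order of \<open>r\<close> and \<open>s\<close>, as needed
  for \<open>W\<close>, which may rise or fall.\<close>

lemma integral_diff_le:
  assumes "0 \<le> r" "0 \<le> s"
  shows "integral {0..s} q - integral {0..r} q \<le> q s * (s - r)"
proof (cases "r \<le> s")
  case True
  have "integral {r..s} q \<le> integral {r..s} (\<lambda>_. q s)"
    using assms by (intro integral_le K_infinity_integrable) (auto simp: K_infinity_le_iff[OF K])
  then show ?thesis
    using assms True by (simp add: integral_diff_eq mult.commute)
next
  case False
  then show ?thesis
    using integral_diff_ge[of s r] assms by (simp add: algebra_simps)
qed

text \<open>Only the right half of \<open>{s - d..s}\<close> is estimated by its lower rectangle.
  The full interval would give \<open>q (s - d)\<close>, which is useless when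
  \<open>d = s\<close>.\<close>

lemma integral_decrease:
  assumes "0 \<le> d" "d \<le> s"
  shows "integral {0..s - d} q - integral {0..s} q \<le> - (d / 2 * q (s - d / 2))"
proof -
  have "0 \<le> q (s - d) * (s - d / 2 - (s - d))"
    using assms by (intro mult_nonneg_nonneg K_infinity_nonneg[OF K]) auto
  also have "\<dots> \<le> integral {0..s - d / 2} q - integral {0..s - d} q"
    by (rule integral_diff_ge) (use assms in auto)
  finally have "integral {0..s - d} q \<le> integral {0..s - d / 2} q"
    by simp
  moreover have "q (s - d / 2) * (d / 2) \<le> integral {0..s} q - integral {0..s - d / 2} q"
    using integral_diff_ge[of "s - d / 2" s] assms by simp
  ultimately show ?thesis
    by (simp add: mult.commute)
qed

lemma K_infinity_integral: "K_infinity (\<lambda>s. integral {0..s} q)"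
proof (rule K_infinityI)
  show "strict_mono_on {0..} (\<lambda>s. integral {0..s} q)"
  proof (rule strict_mono_onI)
    fix r s :: real
    assume "r \<in> {0..}" "s \<in> {0..}" "r < s"
    \<comment> \<open>At \<open>r = 0\<close> the rectangle of height \<open>q r\<close> is empty;
      splitting at the midpoint gives a second rectangle of positive height.\<close>
    then have "0 \<le> q r * ((r + s) / 2 - r)" "0 < q ((r + s) / 2) * (s - (r + s) / 2)"
      by (auto intro!: mult_nonneg_nonneg mult_pos_pos K_infinity_nonneg[OF K] K_infinity_pos[OF K])
    then show "integral {0..r} q < integral {0..s} q"
      using integral_diff_ge[of r "(r + s) / 2"] integral_diff_ge[of "(r + s) / 2" s]
        \<open>r \<in> {0..}\<close> \<open>r < s\<close> by simp
  qed
  show "continuous_on {0..} (\<lambda>s. integral {0..s} q)"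
    unfolding continuous_on_eq_continuous_within
  proof
    fix s :: real
    assume s: "s \<in> {0..}"
    \<comment> \<open>Continuity of a primitive is first obtained on a bounded interval; near
      \<open>s\<close> that interval and \<open>{0..}\<close> coincide.\<close>
    have "continuous_on {0..s + 1} (\<lambda>s. integral {0..s} q)"
      by (intro indefinite_integral_continuous_1 K_infinity_integrable) simp
    then have "continuous (at s within {0..s + 1}) (\<lambda>s. integral {0..s} q)"
      using s by (simp add: continuous_on_eq_continuous_within)
    moreover have "at s within {0..s + 1} = at s within {0..}"
      by (rule at_within_nhd[of _ "{..<s + 1}"]) auto
    ultimately show "continuous (at s within {0..}) (\<lambda>s. integral {0..s} q)"
      by simp
  qed
  fix M
  \<comment> \<open>Chosen so that the rectangle of height \<open>q 1\<close> over
    \<open>{1..s}\<close> has area \<open>q 1 + \<bar>M\<bar>\<close>.\<close>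
  define s where "s = 2 + \<bar>M\<bar> / q 1"
  have "0 < q 1"
    using K_infinity_pos[OF K] by simp
  then have "q 1 * (s - 1) = q 1 + \<bar>M\<bar>"
    by (simp add: s_def field_simps)
  with \<open>0 < q 1\<close> have "M < q 1 * (s - 1)"
    by linarith
  also have "\<dots> \<le> integral {0..s} q - integral {0..1} q"
    using \<open>0 < q 1\<close> by (intro integral_diff_ge) (auto simp: s_def)
  also have "\<dots> \<le> integral {0..s} q"
    using integral_diff_ge[of 0 1] K_infinity_zero[OF K] by simp
  finally show "\<exists>s\<ge>0. M < integral {0..s} q"
    using \<open>0 < q 1\<close> by (intro exI[of _ s]) (auto simp: s_def)
qed simp

end

section \<open>Optimal control and policy iteration\<close>

text \<open>The source of all one-step identities for costs; it also covers divergent series, which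
  are not yet excluded there.\<close>

lemma suminf_ereal_head:
  fixes F :: "nat \<Rightarrow> ereal"
  assumes nonneg: "\<And>n. 0 \<le> F n"
  shows "suminf F = F 0 + (\<Sum>n. F (Suc n))"
proof (rule antisym)
  have "sum F {..<N} \<le> F 0 + (\<Sum>n. F (Suc n))" for N
  proof (cases N)
    case (Suc M)
    then show ?thesis
      using suminf_upper[of "\<lambda>n. F (Suc n)" M] nonneg
      by (simp add: sum.lessThan_Suc_shift add_left_mono del: sum.lessThan_Suc)
  qed (simp add: nonneg suminf_0_le)
  then show "suminf F \<le> F 0 + (\<Sum>n. F (Suc n))"
    using nonneg by (intro suminf_bound) auto
  have "sum (\<lambda>n. F (Suc n)) {..<N} + F 0 \<le> suminf F" for N
    using suminf_upper[of F "Suc N"] nonneg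
    by (simp add: sum.lessThan_Suc_shift add.commute del: sum.lessThan_Suc)
  moreover have "F 0 \<noteq> - \<infinity>"
    using nonneg[of 0] by auto
  ultimately show "F 0 + (\<Sum>n. F (Suc n)) \<le> suminf F"
    using nonneg suminf_bound_add[of "\<lambda>n. F (Suc n)" "F 0"] by (simp add: add.commute)
qed

text \<open>The recursion appends a last step, whereas dynamic programming removes the first
  one.\<close>

lemma closed_loop_Suc_shift:
  "closed_loop f (Suc k) x h = closed_loop f k (f x (h x)) h"
  by (induction k) auto

lemma solution_Suc_shift:
  "solution f x u (Suc k) = solution f (f x (u 0)) (\<lambda>k. u (Suc k)) k"
  by (induction k) auto

lemma solution_feedback:
  "solution f x (\<lambda>k. h (closed_loop f k x h)) k = closed_loop f k x h"
  by (induction k) auto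

section \<open>Dynamic programming for the optimal cost and for a fixed policy\<close>

locale infinite_horizon =
  fixes f :: "'x \<Rightarrow> 'u \<Rightarrow> 'x" and U :: "'x \<Rightarrow> 'u set" and l :: "'x \<Rightarrow> 'u \<Rightarrow> real"
  assumes l_nonneg: "\<And>x u. 0 \<le> l x u"
    and optimal_sequence: "\<And>x. \<exists>u. admissible f U x u \<and> seq_cost f l x u = opt_cost f U l x
      \<and> opt_cost f U l x < \<infinity>"
begin

lemma policy_cost_step: "policy_cost f l x h = ereal (l x (h x)) + policy_cost f l (f x (h x)) h"
  unfolding policy_cost_def
  by (subst suminf_ereal_head) (auto simp: l_nonneg closed_loop_Suc_shift simp del: closed_loop.simps(2))

lemma seq_cost_step:
  "seq_cost f l x u = ereal (l x (u 0)) + seq_cost f l (f x (u 0)) (\<lambda>k. u (Suc k))"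
  unfolding seq_cost_def
  by (subst suminf_ereal_head) (auto simp: l_nonneg solution_Suc_shift simp del: solution.simps(2))

lemma admissible_step:
  "admissible f U x u \<longleftrightarrow> u 0 \<in> U x \<and> admissible f U (f x (u 0)) (\<lambda>k. u (Suc k))"
proof -
  have split: "(\<forall>k. P k) \<longleftrightarrow> P 0 \<and> (\<forall>k. P (Suc k))" for P :: "nat \<Rightarrow> bool"
    by (metis nat.exhaust)
  show ?thesis
    unfolding admissible_def split[of "\<lambda>k. u k \<in> U (solution f x u k)"]
    by (simp add: solution_Suc_shift del: solution.simps(2))
qed

lemma policy_cost_nonneg: "0 \<le> policy_cost f l x h"
  unfolding policy_cost_def by (intro suminf_0_le) (simp add: l_nonneg)

lemma opt_cost_nonneg: "0 \<le> opt_cost f U l x"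
  unfolding opt_cost_def seq_cost_def by (intro INF_greatest suminf_0_le) (simp add: l_nonneg)

lemma opt_cost_le_seq_cost: "admissible f U x u \<Longrightarrow> opt_cost f U l x \<le> seq_cost f l x u"
  unfolding opt_cost_def by (rule INF_lower) simp

lemma opt_cost_le_policy_cost:
  assumes "\<And>x. h x \<in> U x"
  shows "opt_cost f U l x \<le> policy_cost f l x h"
proof -
  have "seq_cost f l x (\<lambda>k. h (closed_loop f k x h)) = policy_cost f l x h"
    by (simp add: seq_cost_def policy_cost_def solution_feedback)
  moreover have "admissible f U x (\<lambda>k. h (closed_loop f k x h))"
    by (simp add: admissible_def solution_feedback assms)
  ultimately show ?thesis
    using opt_cost_le_seq_cost by metis
qed

text \<open>Prepend \<open>u\<close> to an optimal sequence from \<open>f x u\<close>;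
  \<open>case_nat u w\<close> is that concatenation.\<close>

lemma opt_cost_le_step:
  assumes "u \<in> U x"
  shows "opt_cost f U l x \<le> ereal (l x u) + opt_cost f U l (f x u)"
proof -
  obtain w where w: "admissible f U (f x u) w" "seq_cost f l (f x u) w = opt_cost f U l (f x u)"
    using optimal_sequence by blast
  then have "admissible f U x (case_nat u w)"
    using assms by (subst admissible_step) simp
  then have "opt_cost f U l x \<le> seq_cost f l x (case_nat u w)"
    by (rule opt_cost_le_seq_cost)
  then show ?thesis
    by (subst (asm) seq_cost_step) (simp add: w(2))
qed

text \<open>The first input of an optimal sequence is a minimizer: the tail of the sequence costs at
  least the optimal cost of the successor.\<close>

lemma opt_inputs_nonempty: "opt_inputs f U l x \<noteq> {}"
  and opt_cost_ge_step: "\<exists>u\<in>U x. ereal (l x u) + opt_cost f U l (f x u) \<le> opt_cost f U l x"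
proof -
  obtain w where w: "admissible f U x w" "seq_cost f l x w = opt_cost f U l x"
    using optimal_sequence by blast
  then have "w 0 \<in> U x" "admissible f U (f x (w 0)) (\<lambda>k. w (Suc k))"
    using admissible_step by blast+
  moreover from this have step: "ereal (l x (w 0)) + opt_cost f U l (f x (w 0)) \<le> opt_cost f U l x"
    using opt_cost_le_seq_cost seq_cost_step[of x w] w(2) by (metis add_left_mono)
  ultimately have "w 0 \<in> opt_inputs f U l x"
    using opt_cost_le_step
    by (auto simp: opt_inputs_def greedy_inputs_def is_arg_min_linorder intro: order_trans)
  then show "opt_inputs f U l x \<noteq> {}"
    by blast
  show "\<exists>u\<in>U x. ereal (l x u) + opt_cost f U l (f x u) \<le> opt_cost f U l x"
    using \<open>w 0 \<in> U x\<close> step by blast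
qed

lemma
  assumes "selection hstar (opt_inputs f U l)"
  shows selection_opt_inputs_mem: "hstar x \<in> U x"
    and opt_cost_bellman:
      "opt_cost f U l x = ereal (l x (hstar x)) + opt_cost f U l (f x (hstar x))"
proof -
  \<comment> \<open>\<open>selection\<close> only constrains points where the set is nonempty, so
    attainment of the minimum enters here.\<close>
  have "hstar x \<in> opt_inputs f U l x"
    using assms opt_inputs_nonempty by (auto simp: selection_def)
  then have mem: "hstar x \<in> U x"
    and min: "\<And>u. u \<in> U x \<Longrightarrow> ereal (l x (hstar x)) + opt_cost f U l (f x (hstar x))
      \<le> ereal (l x u) + opt_cost f U l (f x u)"
    by (auto simp: opt_inputs_def greedy_inputs_def is_arg_min_linorder)
  show "hstar x \<in> U x" by (fact mem)
  obtain u where "u \<in> U x" "ereal (l x u) + opt_cost f U l (f x u) \<le> opt_cost f U l x"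
    using opt_cost_ge_step by blast
  then show "opt_cost f U l x = ereal (l x (hstar x)) + opt_cost f U l (f x (hstar x))"
    using min opt_cost_le_step[OF mem] by (meson antisym order_trans)
qed

text \<open>Comparison principle: summing the inequality along the closed loop telescopes, and the
  remaining value of \<open>V\<close> at the end point is nonnegative.\<close>

lemma policy_cost_le:
  assumes nonneg: "\<And>x. 0 \<le> V x" and step: "\<And>x. ereal (l x (h x)) + V (f x (h x)) \<le> V x"
  shows "policy_cost f l x h \<le> V x"
proof -
  let ?c = "\<lambda>k. ereal (l (closed_loop f k x h) (h (closed_loop f k x h)))"
  have partial: "sum ?c {..<N} + V (closed_loop f N x h) \<le> V x" for N
  proof (induction N)
    case (Suc N)
    have "sum ?c {..<Suc N} + V (closed_loop f (Suc N) x h)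
        = sum ?c {..<N} + (?c N + V (f (closed_loop f N x h) (h (closed_loop f N x h))))"
      by (simp add: add.assoc del: sum_ereal plus_ereal.simps)
    also have "\<dots> \<le> sum ?c {..<N} + V (closed_loop f N x h)"
      by (intro add_left_mono step)
    finally show ?case
      using Suc by (rule order_trans)
  qed simp
  have "sum ?c {..<N} \<le> V x" for N
    using order_trans[OF _ partial] add_left_mono[OF nonneg[of "closed_loop f N x h"], of "sum ?c {..<N}"]
    by simp
  then show ?thesis
    unfolding policy_cost_def by (intro suminf_bound) (auto simp: l_nonneg)
qed

end

section \<open>Policy improvement and the suboptimality estimate\<close>

locale policy_iteration = infinite_horizon f U l
  for f :: "'x \<Rightarrow> 'u \<Rightarrow> 'x" and U :: "'x \<Rightarrow> 'u set" and l :: "'x \<Rightarrow> 'u \<Rightarrow> real" +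
  fixes h :: "nat \<Rightarrow> 'x \<Rightarrow> 'u"
  assumes h0_mem: "\<And>x. h 0 x \<in> U x"
    and h0_finite: "\<And>x. policy_cost f l x (h 0) < \<infinity>"
    and h_Suc_greedy: "\<And>i x. h (Suc i) x \<in> greedy_inputs f U l (PI_cost f l h i) x"
begin

lemma h_mem: "h i x \<in> U x"
  using h0_mem h_Suc_greedy[of "i - 1" x]
  by (cases i) (auto simp: greedy_inputs_def is_arg_min_linorder)

lemma h_Suc_min:
  "u \<in> U x \<Longrightarrow> ereal (l x (h (Suc i) x)) + PI_cost f l h i (f x (h (Suc i) x))
    \<le> ereal (l x u) + PI_cost f l h i (f x u)"
  using h_Suc_greedy[of i x] by (auto simp: greedy_inputs_def is_arg_min_linorder)

lemma PI_cost_step: "PI_cost f l h i x = ereal (l x (h i x)) + PI_cost f l h i (f x (h i x))"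
  unfolding PI_cost_def by (rule policy_cost_step)

lemma PI_cost_nonneg: "0 \<le> PI_cost f l h i x"
  unfolding PI_cost_def by (rule policy_cost_nonneg)

text \<open>The greedy input does at least as well as \<open>h i x\<close>, so the cost of step
  \<open>i\<close> satisfies the hypothesis of \<open>policy_cost_le\<close> for the policy
  \<open>h (Suc i)\<close>.\<close>

lemma PI_cost_Suc_le: "PI_cost f l h (Suc i) x \<le> PI_cost f l h i x"
proof -
  have "ereal (l x (h (Suc i) x)) + PI_cost f l h i (f x (h (Suc i) x)) \<le> PI_cost f l h i x" for x
    using h_Suc_min[OF h_mem] PI_cost_step[of i x] by metis
  then show ?thesis
    using policy_cost_le[of "PI_cost f l h i"] PI_cost_nonneg by (simp add: PI_cost_def)
qed

text \<open>A step of policy iteration is at least as good as a step of value iteration: replace the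
  new cost at the successor by the old one, then use minimality of the greedy input.\<close>

lemma PI_cost_Suc_le_step:
  assumes "u \<in> U x"
  shows "PI_cost f l h (Suc i) x \<le> ereal (l x u) + PI_cost f l h i (f x u)"
  by (subst PI_cost_step) (rule order_trans[OF add_left_mono[OF PI_cost_Suc_le] h_Suc_min[OF assms]])

lemma PI_cost_finite: "PI_cost f l h i x < \<infinity>"
proof (induction i)
  case (Suc i)
  then show ?case using PI_cost_Suc_le le_less_trans by blast
next
  case 0
  show ?case using h0_finite[of x] by (simp add: PI_cost_def)
qed

lemma opt_cost_finite: "opt_cost f U l x < \<infinity>"
  using optimal_sequence by blast

text \<open>All costs are finite, so differences can be treated in real arithmetic, where the common
  stage cost cancels.\<close>

definition V :: "nat \<Rightarrow> 'x \<Rightarrow> real" where "V i x = real_of_ereal (PI_cost f l h i x)"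
definition Vopt :: "'x \<Rightarrow> real" where "Vopt x = real_of_ereal (opt_cost f U l x)"

lemma PI_cost_eq: "PI_cost f l h i x = ereal (V i x)"
  using PI_cost_finite[of i x] PI_cost_nonneg[of i x]
  by (cases "PI_cost f l h i x") (auto simp: V_def)

lemma opt_cost_eq: "opt_cost f U l x = ereal (Vopt x)"
  using opt_cost_finite[of x] opt_cost_nonneg[of x]
  by (cases "opt_cost f U l x") (auto simp: Vopt_def)

lemma Vopt_le_V: "Vopt x \<le> V i x"
  using opt_cost_le_policy_cost[of "h i" x, OF h_mem]
  by (simp add: PI_cost_eq[unfolded PI_cost_def] opt_cost_eq)

lemma Vopt_nonneg: "0 \<le> Vopt x"
  using opt_cost_nonneg[of x] by (simp add: opt_cost_eq)

context
  fixes hstar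
  assumes hstar: "selection hstar (opt_inputs f U l)"
begin

lemma Vopt_bellman: "Vopt x = l x (hstar x) + Vopt (f x (hstar x))"
  using opt_cost_bellman[OF hstar, of x] by (simp add: opt_cost_eq)

lemma suboptimality_le: "V i x - Vopt x \<le> V 0 (closed_loop f i x hstar) - Vopt (closed_loop f i x hstar)"
proof (induction i arbitrary: x)
  case (Suc i)
  have "V (Suc i) x \<le> l x (hstar x) + V i (f x (hstar x))"
    using PI_cost_Suc_le_step[OF selection_opt_inputs_mem[OF hstar], of i x] by (simp add: PI_cost_eq)
  then have "V (Suc i) x - Vopt x \<le> V i (f x (hstar x)) - Vopt (f x (hstar x))"
    using Vopt_bellman[of x] by simp
  also note Suc.IH[of "f x (hstar x)"]
  finally show ?case
    unfolding closed_loop_Suc_shift .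
qed simp

end

end

section \<open>Bounding functions\<close>

lemma K_infinity_ident: "K_infinity (\<lambda>s. s)"
proof (rule K_infinityI)
  fix M :: real
  show "\<exists>s\<ge>0. M < s"
    by (intro exI[of _ "\<bar>M\<bar> + 1"]) auto
qed (auto intro: strict_mono_onI)

lemma running_max_comparison:
  assumes "continuous_on {0..} a" "a 0 = 0"
  shows "mono_on {0..} (running_max a) \<and> running_max a 0 = 0
    \<and> ((\<exists>\<^sub>F s in at_right 0. 0 < a s) \<longrightarrow> positive_definite (running_max a))"
  using assms mono_on_running_max[of a] running_max_positive_definite[of a]
  by (auto simp: running_max_def)

locale detectability_functions =
  fixes ch aW bW bV :: "real \<Rightarrow> real"
  assumes ch_K: "K_infinity ch" and aW_K: "K_infinity aW" and bV_K: "K_infinity bV"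
    and bW_cont: "continuous_on {0..} bW" and bW_mono: "mono_on {0..} bW" and bW_zero: "bW 0 = 0"
begin

lemma bW_nonneg: "0 \<le> s \<Longrightarrow> 0 \<le> bW s"
  using mono_onD[OF bW_mono, of 0 s] bW_zero by simp

lemma bW_comp:
  assumes "K_infinity a"
  shows "continuous_on {0..} (\<lambda>s. bW (a s))" "mono_on {0..} (\<lambda>s. bW (a s))" "bW (a 0) = 0"
proof -
  show "continuous_on {0..} (\<lambda>s. bW (a s))"
    by (rule continuous_on_compose2[OF bW_cont K_infinity_cont[OF assms]])
      (auto simp: K_infinity_nonneg[OF assms])
  show "mono_on {0..} (\<lambda>s. bW (a s))"
    by (auto intro!: mono_onI mono_onD[OF bW_mono]
        simp: K_infinity_nonneg[OF assms] K_infinity_le_iff[OF assms])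
  show "bW (a 0) = 0"
    by (simp add: K_infinity_zero[OF assms] bW_zero)
qed

lemma comp_bW:
  assumes "K_infinity a"
  shows "continuous_on {0..} (\<lambda>s. a (bW s))" "mono_on {0..} (\<lambda>s. a (bW s))" "a (bW 0) = 0"
proof -
  show "continuous_on {0..} (\<lambda>s. a (bW s))"
    by (rule continuous_on_K_infinity[OF assms bW_cont]) (simp add: bW_nonneg)
  show "mono_on {0..} (\<lambda>s. a (bW s))"
    by (auto intro!: mono_onI mono_onD[OF bW_mono] simp: bW_nonneg K_infinity_le_iff[OF assms])
  show "a (bW 0) = 0"
    by (simp add: K_infinity_zero[OF assms] bW_zero)
qed

text \<open>The function inverted in \<open>q_W\<close>. If \<open>aW s < 2 * ch c\<close>, then
  \<open>phi c\<close> bounds the next value of \<open>W\<close>, so \<open>q_W\<close> of that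
  value is at most \<open>c / 2\<close>.\<close>

definition "phi r = ch r + (bW (kinv aW (2 * ch r)) + kinv aW (2 * ch r))"

lemma phi_K: "K_infinity phi"
proof -
  have m: "K_infinity (\<lambda>r. kinv aW (2 * ch r))"
    by (intro K_infinity_compose[OF K_infinity_kinv[OF aW_K]] K_infinity_scale ch_K) simp
  then have "K_infinity (\<lambda>r. kinv aW (2 * ch r) + bW (kinv aW (2 * ch r)))"
    by (intro K_infinity_add bW_comp) auto
  then have "K_infinity (\<lambda>r. ch r + (kinv aW (2 * ch r) + bW (kinv aW (2 * ch r))))"
    by (intro K_infinity_add[OF ch_K] K_infinity_cont K_infinity_mono_on K_infinity_zero)
  then show ?thesis
    by (simp add: phi_def[abs_def] add.commute)
qed

lemma q_W_eq: "q_W ch aW bW s = kinv phi s / 2"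
  by (simp add: q_W_def phi_def[abs_def])

lemma q_W_K: "K_infinity (q_W ch aW bW)"
proof -
  have "K_infinity (\<lambda>s. 1 / 2 * kinv phi s)"
    by (rule K_infinity_scale[OF K_infinity_kinv[OF phi_K]]) simp
  then show ?thesis
    by (simp add: q_W_eq[abs_def])
qed

lemma q_V_K: "K_infinity (q_V ch)"
  unfolding q_V_def[abs_def]
  by (intro K_infinity_scale K_infinity_compose[OF ch_K] K_infinity_ident) simp_all

lemma rho_V_K: "K_infinity (rho_V ch)"
  unfolding rho_V_def[abs_def] by (rule K_infinity_integral[OF q_V_K])

lemma rho_W_K: "K_infinity (rho_W ch aW bW)"
  unfolding rho_W_def[abs_def] by (rule K_infinity_integral[OF q_W_K])

lemma comparison_triple_gen:
  "comparison_triple (alpha_Y_lo ch aW bW) (alpha_Y_up ch aW bW bV) (alpha_Y ch aW bW)"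
proof
  have quarter: "K_infinity (\<lambda>s. 1 / 4 * aW s)" and half: "K_infinity (\<lambda>s. 1 / 2 * aW s)"
    by (intro K_infinity_scale aW_K, simp)+
  note q = K_infinity_compose[OF q_W_K quarter]
  show "K_infinity (alpha_Y_lo ch aW bW)"
    unfolding alpha_Y_lo_def[abs_def]
    by (intro K_infinity_min K_infinity_compose[OF rho_V_K] K_infinity_compose[OF rho_W_K]
        K_infinity_compose[OF K_infinity_kinv[OF ch_K]] half)
  show "K_infinity (alpha_Y_up ch aW bW bV)"
    unfolding alpha_Y_up_def[abs_def]
    by (intro K_infinity_add[OF K_infinity_compose[OF rho_V_K bV_K]] comp_bW[OF rho_W_K])
  show "continuous_on {0..} (alpha_Y ch aW bW)"
    unfolding alpha_Y_def[abs_def]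
    by (intro continuous_on_mult K_infinity_cont[OF q] K_infinity_cont[OF quarter])
  show "mono_on {0..} (alpha_Y ch aW bW)"
  proof (rule mono_onI)
    fix r s :: real
    assume "r \<in> {0..}" "s \<in> {0..}" "r \<le> s"
    then have "q_W ch aW bW (1 / 4 * aW r) \<le> q_W ch aW bW (1 / 4 * aW s)"
      "1 / 4 * aW r \<le> 1 / 4 * aW s" "0 \<le> q_W ch aW bW (1 / 4 * aW s)" "0 \<le> 1 / 4 * aW r"
      using K_infinity_le_iff[OF q, of r s] K_infinity_le_iff[OF quarter, of r s]
        K_infinity_nonneg[OF q, of s] K_infinity_nonneg[OF quarter, of r] by simp_all
    then show "alpha_Y ch aW bW r \<le> alpha_Y ch aW bW s"
      unfolding alpha_Y_def by (rule mult_mono)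
  qed
  show "alpha_Y ch aW bW 0 = 0"
    using K_infinity_zero[OF quarter] by (simp add: alpha_Y_def)
  show "0 < alpha_Y ch aW bW s" if "0 < s" for s
    unfolding alpha_Y_def
    using K_infinity_pos[OF q that] K_infinity_pos[OF quarter that] by (rule mult_pos_pos)
qed

lemma alpha_hat_gen_cont: "continuous_on {0..} (alpha_hat_gen ch aW bW bV)"
  unfolding alpha_hat_gen_def[abs_def]
  by (intro continuous_on_diff continuous_on_kinv[OF ch_K] continuous_on_max continuous_on_const
      K_infinity_cont bV_K aW_K bW_cont)

lemma alpha_hat_gen_zero: "alpha_hat_gen ch aW bW bV 0 = 0"
  by (simp add: alpha_hat_gen_def K_infinity_zero[OF bV_K] K_infinity_zero[OF aW_K] bW_zero
      kinv_nonpos[OF ch_K])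

text \<open>This explains both factors 2 in \<open>q_V\<close>: the inner one compensates for
  evaluation at \<open>v - c / 2\<close>, which is at least \<open>v / 2\<close>, the outer one for
  the loss of half the interval in \<open>integral_decrease\<close>.\<close>

lemma rho_V_decrease:
  assumes "0 \<le> c" "c \<le> v"
  shows "rho_V ch (v - c) - rho_V ch v \<le> - (c * ch v)"
proof -
  have "ch v \<le> ch (2 * (v - c / 2))"
    using assms by (simp add: K_infinity_le_iff[OF ch_K])
  then have "c / 2 * (2 * ch v) \<le> c / 2 * q_V ch (v - c / 2)"
    using assms(1) unfolding q_V_def by (intro mult_left_mono) auto
  then show ?thesis
    using integral_decrease[OF q_V_K assms] unfolding rho_V_def by simp
qed

text \<open>A cost \<open>c\<close> that is small relative to \<open>aW s\<close> makes \<open>w\<close> decrease; otherwise \<open>q_W\<close> is chosen so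
  that the growth of \<open>rho_W w\<close> is at most half of the decrease of \<open>rho_V v\<close>.\<close>

lemma rho_decrease:
  assumes c: "0 \<le> c" "c \<le> v" and s: "0 \<le> s" and w: "0 \<le> w" "w \<le> bW s"
    and w': "0 \<le> w'" "w' \<le> w - aW s + ch c"
  shows "rho_V ch (v - c) + rho_W ch aW bW w' \<le> rho_V ch v + rho_W ch aW bW w - alpha_Y ch aW bW s"
proof -
  let ?q = "q_W ch aW bW" and ?R = "rho_W ch aW bW"
  define a where "a = aW s"
  have "0 \<le> a"
    unfolding a_def using s by (rule K_infinity_nonneg[OF aW_K])
  have "0 \<le> v" using c by simp
  have chc: "0 \<le> ch c" "ch c \<le> ch v"
    using c K_infinity_nonneg[OF ch_K] by (auto simp: K_infinity_le_iff[OF ch_K])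
  have V: "rho_V ch (v - c) - rho_V ch v \<le> - (c * ch c)"
    using rho_V_decrease[OF c] mult_left_mono[OF chc(2) c(1)] by linarith
  have aY: "alpha_Y ch aW bW s = ?q (a / 4) * (a / 4)"
    by (simp add: alpha_Y_def a_def)
  show ?thesis
  proof (cases "ch c \<le> a / 2")
    case True
    \<comment> \<open>Small cost: \<open>w\<close> falls by at least \<open>a / 2\<close>. With
      \<open>d = a / 2\<close> in \<open>integral_decrease\<close> the slope is taken at
      \<open>w - a / 4\<close>, which is at least \<open>a / 4\<close>; hence the quarters in
      \<open>alpha_Y\<close>.\<close>
    then have le: "w' \<le> w - a / 2" and "a / 2 \<le> w"
      using w' by (auto simp: a_def)
    have "?R w' \<le> ?R (w - a / 2)"
      using le w'(1) by (simp add: K_infinity_le_iff[OF rho_W_K])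
    also have "\<dots> - ?R w \<le> - (a / 4 * ?q (w - a / 4))"
      using integral_decrease[OF q_W_K, of "a / 2" w] \<open>0 \<le> a\<close> \<open>a / 2 \<le> w\<close>
      by (simp add: rho_W_def)
    finally have "?R w' - ?R w \<le> - (a / 4 * ?q (w - a / 4))"
      by simp
    moreover have "?q (a / 4) \<le> ?q (w - a / 4)"
      using \<open>0 \<le> a\<close> \<open>a / 2 \<le> w\<close> by (simp add: K_infinity_le_iff[OF q_W_K])
    then have "a / 4 * ?q (a / 4) \<le> a / 4 * ?q (w - a / 4)"
      using \<open>0 \<le> a\<close> by (intro mult_left_mono) auto
    moreover have "0 \<le> c * ch c"
      using c chc by simp
    ultimately show ?thesis
      using V aY by (simp add: mult.commute)
  next
    case False
    \<comment> \<open>Large cost: \<open>s\<close>, and with it \<open>w\<close>, is now bounded by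
      a function of \<open>c\<close> alone.\<close>
    have "s \<le> kinv aW (2 * ch c)"
      using False s chc by (simp add: le_kinv_iff[OF aW_K] a_def)
    then have "bW s \<le> bW (kinv aW (2 * ch c))"
      using s by (intro mono_onD[OF bW_mono]) (auto simp: kinv_nonneg[OF aW_K])
    then have "w' \<le> phi c" and chphi: "ch c \<le> phi c"
      using w w' kinv_nonneg[OF aW_K, of "2 * ch c"] bW_nonneg[OF kinv_nonneg[OF aW_K, of "2 * ch c"]]
        \<open>0 \<le> a\<close> by (auto simp: phi_def a_def)
    have q: "?q (phi c) = c / 2"
      using c by (simp add: q_W_eq kinv_left[OF phi_K])
    have "0 \<le> phi c"
      using chphi chc by simp
    have qw': "0 \<le> ?q w'" "?q w' \<le> c / 2"
      using w'(1) \<open>w' \<le> phi c\<close> \<open>0 \<le> phi c\<close> K_infinity_nonneg[OF q_W_K]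
      by (auto simp: q[symmetric] K_infinity_le_iff[OF q_W_K])
    have "?R w' - ?R w \<le> ?q w' * (w' - w)"
      using integral_diff_le[OF q_W_K w(1) w'(1)] by (simp add: rho_W_def)
    also have "\<dots> \<le> ?q w' * ch c"
      using w'(2) \<open>0 \<le> a\<close> qw' by (intro mult_left_mono) (auto simp: a_def)
    also have "\<dots> \<le> c / 2 * ch c"
      using qw' chc by (intro mult_right_mono)
    finally have W: "?R w' - ?R w \<le> c / 2 * ch c" .
    have "?q (a / 4) \<le> ?q (phi c)"
      using False chphi \<open>0 \<le> a\<close> \<open>0 \<le> phi c\<close> by (simp add: K_infinity_le_iff[OF q_W_K])
    then have "?q (a / 4) * (a / 4) \<le> c / 2 * ch c"
      unfolding q using False \<open>0 \<le> a\<close> c by (intro mult_mono) auto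
    then show ?thesis
      using V W aY by (simp add: field_simps)
  qed
qed

text \<open>One of \<open>w\<close> and \<open>ch v\<close> is at least half of \<open>aW s\<close>;
  the minimum in \<open>alpha_Y_lo\<close> covers both possibilities.\<close>

lemma alpha_Y_lo_le:
  assumes s: "0 \<le> s" and v: "0 \<le> v" and w: "0 \<le> w" and le: "aW s \<le> w + ch v"
  shows "alpha_Y_lo ch aW bW s \<le> rho_V ch v + rho_W ch aW bW w"
proof -
  have nonneg: "0 \<le> rho_V ch v" "0 \<le> rho_W ch aW bW w" "0 \<le> aW s"
    using s v w by (auto intro: K_infinity_nonneg[OF rho_V_K] K_infinity_nonneg[OF rho_W_K]
        K_infinity_nonneg[OF aW_K])
  show ?thesis
  proof (cases "1 / 2 * aW s \<le> w")
    case True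
    then have "rho_W ch aW bW (1 / 2 * aW s) \<le> rho_W ch aW bW w"
      using nonneg w by (simp add: K_infinity_le_iff[OF rho_W_K])
    then show ?thesis
      using nonneg unfolding alpha_Y_lo_def by linarith
  next
    case False
    then have "kinv ch (1 / 2 * aW s) \<le> v"
      using le nonneg v by (simp add: kinv_le_iff[OF ch_K])
    then have "rho_V ch (kinv ch (1 / 2 * aW s)) \<le> rho_V ch v"
      using v by (simp add: K_infinity_le_iff[OF rho_V_K] kinv_nonneg[OF ch_K])
    then show ?thesis
      using nonneg unfolding alpha_Y_lo_def by linarith
  qed
qed

lemma comparison_triple_id: "comparison_triple aW (\<lambda>s. bV s + bW s) aW"
  by unfold_locales
    (auto intro: aW_K bV_K bW_cont bW_mono bW_zero K_infinity_add K_infinity_cont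
      K_infinity_mono_on K_infinity_zero K_infinity_pos)

lemma alpha_hat_id_cont: "continuous_on {0..} (alpha_hat_id aW bW bV)"
  unfolding alpha_hat_id_def[abs_def]
  by (intro continuous_on_min continuous_on_diff continuous_on_add K_infinity_cont bV_K aW_K bW_cont)

lemma alpha_hat_id_zero: "alpha_hat_id aW bW bV 0 = 0"
  by (simp add: alpha_hat_id_def K_infinity_zero[OF bV_K] K_infinity_zero[OF aW_K] bW_zero)

end

section \<open>Decrease along optimal trajectories\<close>

locale detectable_policy_iteration =
  policy_iteration f U l h + detectability_functions ch aW bW bV
  for f :: "'x \<Rightarrow> 'u \<Rightarrow> 'x" and U :: "'x \<Rightarrow> 'u set" and l :: "'x \<Rightarrow> 'u \<Rightarrow> real"
    and h :: "nat \<Rightarrow> 'x \<Rightarrow> 'u" and ch aW bW bV :: "real \<Rightarrow> real" +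
  fixes \<sigma> W :: "'x \<Rightarrow> real"
  assumes \<sigma>_nonneg: "\<And>x. 0 \<le> \<sigma> x" and W_nonneg: "\<And>x. 0 \<le> W x"
    and W_le: "\<And>x. W x \<le> bW (\<sigma> x)"
    and W_step: "\<And>x u. u \<in> U x \<Longrightarrow> W (f x u) - W x \<le> - aW (\<sigma> x) + ch (l x u)"
    and initial_cost_le: "\<And>x. policy_cost f l x (h 0) \<le> ereal (bV (\<sigma> x))"
begin

text \<open>The bound in terms of \<open>\<sigma>\<close> mentions no optimal policy, so one is
  fixed by choice.\<close>

definition hs :: "'x \<Rightarrow> 'u" where "hs x = (SOME u. u \<in> opt_inputs f U l x)"

lemma hs_selection: "selection hs (opt_inputs f U l)"
  unfolding selection_def hs_def by (auto intro: someI)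

definition "c x = l x (hs x)"

lemma c_nonneg: "0 \<le> c x"
  by (simp add: c_def l_nonneg)

lemma Vopt_next: "Vopt (f x (hs x)) = Vopt x - c x"
  using Vopt_bellman[OF hs_selection, of x] by (simp add: c_def)

lemma c_le: "c x \<le> Vopt x"
  using Vopt_next[of x] Vopt_nonneg[of "f x (hs x)"] by simp

lemma W_next: "W (f x (hs x)) \<le> W x - aW (\<sigma> x) + ch (c x)"
  using W_step[OF selection_opt_inputs_mem[OF hs_selection], of x] by (simp add: c_def)

text \<open>\<open>W\<close> is nonnegative at the successor, so it cannot lose more than
  \<open>W x\<close> plus the supply. All lower bounds on the Lyapunov functions and on
  \<open>Vopt\<close> start here.\<close>

lemma aW_le_c: "aW (\<sigma> x) \<le> W x + ch (c x)"
  using W_next[of x] W_nonneg[of "f x (hs x)"] by simp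

lemma aW_le: "aW (\<sigma> x) \<le> W x + ch (Vopt x)"
  using aW_le_c[of x] c_le[of x] c_nonneg[of x] K_infinity_le_iff[OF ch_K, of "c x" "Vopt x"] by simp

lemma V0_le: "V 0 x \<le> bV (\<sigma> x)"
  using initial_cost_le[of x] by (simp add: PI_cost_eq[unfolded PI_cost_def])

lemma Vopt_le: "Vopt x \<le> bV (\<sigma> x)"
  using Vopt_le_V V0_le by (rule order_trans)

text \<open>\<open>\<sigma>\<close> along the trajectory is known only from above and
  \<open>ah\<close> need not be monotone, hence the running maximum.\<close>

lemma PI_bound:
  assumes "continuous_on {0..} ah" and "\<And>x. V 0 x - Vopt x \<le> ah (\<sigma> x)"
    and "\<sigma> (closed_loop f i x hs) \<le> b"
  shows "PI_cost f l h i x - opt_cost f U l x \<le> ereal (running_max ah b)"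
proof -
  let ?y = "closed_loop f i x hs"
  have "V i x - Vopt x \<le> V 0 ?y - Vopt ?y"
    by (rule suboptimality_le[OF hs_selection])
  also have "\<dots> \<le> ah (\<sigma> ?y)" by (fact assms(2))
  also have "\<dots> \<le> running_max ah b"
    using assms(3) by (intro running_max_upper[OF assms(1)] \<sigma>_nonneg)
  finally show ?thesis by (simp add: PI_cost_eq opt_cost_eq)
qed

lemma lyapunov_bound:
  assumes "comparison_triple lo up aY"
    and "\<And>x. lo (\<sigma> x) \<le> Y x" "\<And>x. Y x \<le> up (\<sigma> x)" "\<And>x. Y (f x (hs x)) \<le> Y x - aY (\<sigma> x)"
  shows "\<sigma> (closed_loop f i x hs) \<le> beta_fun lo (\<lambda>s. aY (kinv up s)) up (\<sigma> x) i"
  using comparison_triple.beta_fun_bound[OF assms(1), of "\<lambda>k. \<sigma> (closed_loop f k x hs)"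
      "\<lambda>k. Y (closed_loop f k x hs)" i] assms(2-4) \<sigma>_nonneg
  by simp

text \<open>\<open>V 0\<close> is bounded above by \<open>bV\<close>, and \<open>Vopt\<close> below
  by inverting \<open>ch (Vopt x) \<ge> aW (\<sigma> x) - bW (\<sigma> x)\<close>;
  \<open>max 0\<close> handles a negative right-hand side.\<close>

lemma V0_diff_le_gen: "V 0 x - Vopt x \<le> alpha_hat_gen ch aW bW bV (\<sigma> x)"
proof -
  have "aW (\<sigma> x) - bW (\<sigma> x) \<le> ch (Vopt x)"
    using aW_le[of x] W_le[of x] by simp
  then have "max 0 (aW (\<sigma> x) - bW (\<sigma> x)) \<le> ch (Vopt x)"
    using K_infinity_nonneg[OF ch_K Vopt_nonneg] by simp
  then have "kinv ch (max 0 (aW (\<sigma> x) - bW (\<sigma> x))) \<le> Vopt x"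
    by (simp add: kinv_le_iff[OF ch_K] Vopt_nonneg)
  then show ?thesis
    using V0_le[of x] by (simp add: alpha_hat_gen_def)
qed

lemma sigma_bound_gen: "\<sigma> (closed_loop f i x hs) \<le> beta_gen ch aW bW bV (\<sigma> x) i"
proof -
  define Y where "Y x = rho_V ch (Vopt x) + rho_W ch aW bW (W x)" for x
  have "alpha_Y_lo ch aW bW (\<sigma> x) \<le> Y x" for x
    unfolding Y_def by (intro alpha_Y_lo_le \<sigma>_nonneg Vopt_nonneg W_nonneg aW_le)
  moreover have "Y x \<le> alpha_Y_up ch aW bW bV (\<sigma> x)" for x
    unfolding Y_def alpha_Y_up_def
    using Vopt_le[of x] W_le[of x] Vopt_nonneg[of x] W_nonneg[of x]
    by (intro add_mono mono_onD[OF K_infinity_mono_on[OF rho_V_K]]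
        mono_onD[OF K_infinity_mono_on[OF rho_W_K]]) auto
  moreover have "Y (f x (hs x)) \<le> Y x - alpha_Y ch aW bW (\<sigma> x)" for x
    unfolding Y_def Vopt_next
    by (intro rho_decrease c_nonneg c_le \<sigma>_nonneg W_nonneg W_le W_next)
  ultimately show ?thesis
    using lyapunov_bound[OF comparison_triple_gen, of Y]
    by (simp add: beta_gen_def alpha_Y_tilde_def[abs_def])
qed

lemma class_KL_beta_gen: "class_KL (beta_gen ch aW bW bV)"
  using comparison_triple.class_KL_beta_fun[OF comparison_triple_gen]
  by (simp add: beta_gen_def alpha_Y_tilde_def[abs_def])

lemma class_KL_beta_id: "class_KL (beta_id aW bW bV)"
  using comparison_triple.class_KL_beta_fun[OF comparison_triple_id] by (simp add: beta_id_def)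

section \<open>Supply rate at most the identity\<close>

context
  assumes ch_le: "\<And>s. 0 \<le> s \<Longrightarrow> ch s \<le> s"
begin

text \<open>The two entries of the minimum come from the lower bounds 0 and
  \<open>aW (\<sigma> x) - bW (\<sigma> x)\<close> for \<open>Vopt x\<close>.\<close>

lemma V0_diff_le_id: "V 0 x - Vopt x \<le> alpha_hat_id aW bW bV (\<sigma> x)"
  using aW_le[of x] W_le[of x] ch_le[OF Vopt_nonneg, of x] V0_le[of x] Vopt_nonneg[of x]
  by (simp add: alpha_hat_id_def)

lemma sigma_bound_id: "\<sigma> (closed_loop f i x hs) \<le> beta_id aW bW bV (\<sigma> x) i"
proof -
  have "aW (\<sigma> x) \<le> Vopt x + W x" for x
    using aW_le[of x] ch_le[OF Vopt_nonneg, of x] by simp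
  moreover have "Vopt x + W x \<le> bV (\<sigma> x) + bW (\<sigma> x)" for x
    using Vopt_le W_le by (rule add_mono)
  moreover have "Vopt (f x (hs x)) + W (f x (hs x)) \<le> Vopt x + W x - aW (\<sigma> x)" for x
    using Vopt_next[of x] W_next[of x] ch_le[OF c_nonneg, of x] by simp
  ultimately show ?thesis
    using lyapunov_bound[OF comparison_triple_id, of "\<lambda>x. Vopt x + W x"] by (simp add: beta_id_def)
qed

end

section \<open>Linear bounds and exponential decay\<close>

context
  fixes cW a b v :: real
  assumes pos: "0 < cW" "0 < a" "0 < v" "0 \<le> b"
    and lin: "\<And>s. 0 \<le> s \<Longrightarrow> ch s \<le> cW * s" "\<And>s. 0 \<le> s \<Longrightarrow> a * s \<le> aW s"
      "\<And>s. 0 \<le> s \<Longrightarrow> bV s \<le> v * s" "\<And>s. 0 \<le> s \<Longrightarrow> bW s \<le> b * s"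
begin

text \<open>The fall \<open>C * c x\<close> of \<open>C * Vopt\<close> covers the supply
  \<open>ch (c x)\<close>; for \<open>cW \<le> 1\<close> the plain sum \<open>Vopt + W\<close>
  remains.\<close>

abbreviation "C \<equiv> max 1 cW"
abbreviation "A \<equiv> a_Y_up cW b v"

lemma A_pos: "0 < A"
  unfolding a_Y_up_def using pos by (intro add_pos_nonneg mult_pos_pos) auto

lemma C_pos: "0 < C"
  by (simp add: less_max_iff_disj)

lemma ch_le_C: "0 \<le> s \<Longrightarrow> ch s \<le> C * s"
  using lin(1)[of s] mult_right_mono[of cW C s] by simp

definition "Y x = C * Vopt x + W x"

lemma Y_lower: "a * \<sigma> x \<le> Y x"
  using aW_le[of x] lin(2)[OF \<sigma>_nonneg, of x] ch_le_C[OF Vopt_nonneg, of x] by (simp add: Y_def)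

lemma W_le_linear: "W x \<le> b * \<sigma> x"
  using W_le[of x] lin(4)[OF \<sigma>_nonneg, of x] by simp

lemma Vopt_le_linear: "Vopt x \<le> v * \<sigma> x"
  using Vopt_le[of x] lin(3)[OF \<sigma>_nonneg, of x] by simp

lemma Y_upper: "Y x \<le> A * \<sigma> x"
  using mult_left_mono[OF Vopt_le_linear less_imp_le[OF C_pos], of x] W_le_linear[of x]
  by (simp add: Y_def a_Y_up_def algebra_simps)

text \<open>The upper bound \<open>Y x \<le> A * \<sigma> x\<close> converts the additive decrease
  \<open>a * \<sigma> x\<close> into a contraction.\<close>

lemma Y_decrease: "Y (f x (hs x)) \<le> (1 - a / A) * Y x"
proof -
  have "Y (f x (hs x)) \<le> Y x - a * \<sigma> x"
    using W_next[of x] lin(2)[OF \<sigma>_nonneg, of x] ch_le_C[OF c_nonneg, of x]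
    by (simp add: Y_def Vopt_next right_diff_distrib)
  moreover have "a * (Y x / A) \<le> a * \<sigma> x"
    using Y_upper[of x] A_pos pos by (intro mult_left_mono) (simp_all add: field_simps)
  ultimately show ?thesis
    by (simp add: algebra_simps)
qed

text \<open>The two linear bounds on \<open>Y\<close> are compared at a point where
  \<open>\<sigma>\<close> can be cancelled. Without such a point \<open>1 - a / A\<close> may be
  negative, with powers of alternating sign; so class KL is claimed only if \<open>\<sigma>\<close>
  is not identically zero.\<close>

lemma a_le_A: "\<sigma> x \<noteq> 0 \<Longrightarrow> a \<le> A"
  using order_trans[OF Y_lower Y_upper, of x] \<sigma>_nonneg[of x] by simp

lemma class_KL_beta_lin:
  assumes "\<sigma> x \<noteq> 0"
  shows "class_KL (beta_lin cW a b v)"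
proof -
  define r where "r = 1 - a / A"
  have r: "0 \<le> r" "r < 1"
    using a_le_A[OF assms] A_pos pos by (auto simp: r_def)
  define m where "m = A / a"
  have m: "0 \<le> m"
    using A_pos pos by (simp add: m_def)
  have eq: "beta_lin cW a b v = (\<lambda>s k. m * r ^ k * s)"
    by (intro ext) (simp add: beta_lin_def r_def m_def)
  show ?thesis
    unfolding class_KL_def eq
  proof (intro conjI allI impI)
    fix k
    show "mono_on {0..} (\<lambda>s. m * r ^ k * s)"
      using r m by (auto intro!: mono_onI mult_left_mono)
    show "((\<lambda>s. m * r ^ k * s) \<longlongrightarrow> 0) (at_right 0)"
      by (auto intro!: tendsto_eq_intros)
  next
    fix s :: real
    assume s: "0 \<le> s"
    show "0 \<le> m * r ^ k * s" for k
      using r m s by simp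
    show "antimono (\<lambda>k. m * r ^ k * s)"
      using r m s by (intro antimonoI mult_right_mono mult_left_mono power_decreasing) auto
    have "(\<lambda>k. r ^ k) \<longlonglongrightarrow> 0"
      using r by (rule LIMSEQ_realpow_zero)
    then have "(\<lambda>k. m * r ^ k * s) \<longlonglongrightarrow> m * 0 * s"
      by (intro tendsto_mult tendsto_const)
    then show "(\<lambda>k. m * r ^ k * s) \<longlonglongrightarrow> 0"
      by simp
  qed
qed

lemma sigma_bound_lin: "\<sigma> (closed_loop f i x hs) \<le> beta_lin cW a b v (\<sigma> x) i"
proof (cases "\<exists>y. \<sigma> y \<noteq> 0")
  case True
  then have r: "0 \<le> 1 - a / A"
    using a_le_A A_pos by auto
  have "Y (closed_loop f i x hs) \<le> (1 - a / A) ^ i * Y x"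
  proof (induction i)
    case (Suc i)
    have "Y (closed_loop f (Suc i) x hs) \<le> (1 - a / A) * Y (closed_loop f i x hs)"
      using Y_decrease by simp
    also have "\<dots> \<le> (1 - a / A) * ((1 - a / A) ^ i * Y x)"
      using Suc r by (rule mult_left_mono)
    finally show ?case by (simp add: mult.assoc)
  qed simp
  also have "\<dots> \<le> (1 - a / A) ^ i * (A * \<sigma> x)"
    using Y_upper r by (intro mult_left_mono zero_le_power)
  finally have "a * \<sigma> (closed_loop f i x hs) \<le> (1 - a / A) ^ i * (A * \<sigma> x)"
    using Y_lower order_trans by blast
  then show ?thesis
    using pos by (simp add: beta_lin_def field_simps)
next
  \<comment> \<open>With \<open>\<sigma>\<close> identically zero both sides are 0, whatever the
    sign of the ratio.\<close>
  case False
  then show ?thesis by (simp add: beta_lin_def)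
qed

text \<open>The slope \<open>(A - a) / C\<close> arises from
  \<open>C * Vopt x \<ge> (a - b) * \<sigma> x\<close> and \<open>A = C * v + b\<close>, after
  division by the weight \<open>C\<close>.\<close>

lemma V0_diff_le_lin: "V 0 x - Vopt x \<le> alpha_hat_lin cW a b v (\<sigma> x)"
proof -
  have V0: "V 0 x \<le> v * \<sigma> x"
    using V0_le[of x] lin(3)[OF \<sigma>_nonneg, of x] by simp
  have "C * V 0 x \<le> C * (v * \<sigma> x)"
    using V0 less_imp_le[OF C_pos] by (rule mult_left_mono)
  moreover have "a * \<sigma> x \<le> C * Vopt x + b * \<sigma> x"
    using Y_lower[of x] W_le_linear[of x] by (simp add: Y_def)
  ultimately have "C * (V 0 x - Vopt x) \<le> (A - a) * \<sigma> x"
    by (simp add: a_Y_up_def algebra_simps)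
  then have "V 0 x - Vopt x \<le> (A - a) / C * \<sigma> x"
    using C_pos by (simp add: pos_le_divide_eq mult.commute)
  moreover have "V 0 x - Vopt x \<le> v * \<sigma> x"
    using V0 Vopt_nonneg[of x] by simp
  ultimately show ?thesis
    by (simp add: alpha_hat_lin_def min_def)
qed

end

lemma alpha_hat_lin_cont: "continuous_on {0..} (alpha_hat_lin cW a b v)"
  unfolding alpha_hat_lin_def[abs_def] by (intro continuous_intros)

lemma alpha_hat_lin_zero: "alpha_hat_lin cW a b v 0 = 0"
  by (simp add: alpha_hat_lin_def)

end

theorem theorem2:
  fixes f :: "real ^ 'n \<Rightarrow> real ^ 'm \<Rightarrow> real ^ 'n"
    and U :: "real ^ 'n \<Rightarrow> (real ^ 'm) set"
    and l :: "real ^ 'n \<Rightarrow> real ^ 'm \<Rightarrow> real"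
    and \<sigma> W :: "real ^ 'n \<Rightarrow> real"
    and \<chi>W \<alpha>W \<alpha>Wup \<alpha>Vup :: "real \<Rightarrow> real"
    and h :: "nat \<Rightarrow> real ^ 'n \<Rightarrow> real ^ 'm"
  assumes U_nonempty: "\<And>x. U x \<noteq> {}"
    and l_nonneg: "\<And>x u. 0 \<le> l x u"
    and \<sigma>_cont: "continuous_on UNIV \<sigma>"
    and \<sigma>_nonneg: "\<And>x. 0 \<le> \<sigma> x"
    and SA1: "\<And>x. \<exists>u. admissible f U x u \<and> seq_cost f l x u = opt_cost f U l x
                 \<and> opt_cost f U l x < \<infinity>"
    and W_cont: "continuous_on UNIV W"
    and W_nonneg: "\<And>x. 0 \<le> W x"
    and \<alpha>W_K: "K_infinity \<alpha>W"
    and \<chi>W_K: "K_infinity \<chi>W"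
    and \<alpha>Wup_cont: "continuous_on {0..} \<alpha>Wup"
    and \<alpha>Wup_mono: "mono_on {0..} \<alpha>Wup"
    and \<alpha>Wup_zero: "\<alpha>Wup 0 = 0"
    and SA2_bound: "\<And>x. W x \<le> \<alpha>Wup (\<sigma> x)"
    and SA2_decrease: "\<And>x u. u \<in> U x \<Longrightarrow> W (f x u) - W x \<le> - \<alpha>W (\<sigma> x) + \<chi>W (l x u)"
    and \<alpha>Vup_K: "K_infinity \<alpha>Vup"
    and SA3: "\<And>x. policy_cost f l x (h 0) \<le> ereal (\<alpha>Vup (\<sigma> x))"
    and h0_policy: "selection (h 0) U"
    and PI_feasible: "\<And>i x. 0 < i \<Longrightarrow> PI_inputs f U l h i x \<noteq> {}"
    and PI_selection: "\<And>i. 0 < i \<Longrightarrow> selection (h i) (PI_inputs f U l h i)"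
  shows
    "(\<forall>hstar. selection hstar (opt_inputs f U l) \<longrightarrow>
       (\<forall>i x. PI_cost f l h i x - opt_cost f U l x
          \<le> PI_cost f l h 0 (closed_loop f i x hstar) - opt_cost f U l (closed_loop f i x hstar)))
     \<and>
     (let \<beta> = beta_gen \<chi>W \<alpha>W \<alpha>Wup \<alpha>Vup;
          \<alpha>hat = alpha_hat_gen \<chi>W \<alpha>W \<alpha>Wup \<alpha>Vup;
          \<alpha>tilde = running_max \<alpha>hat
      in class_KL \<beta> \<and> mono_on {0..} \<alpha>tilde \<and> \<alpha>tilde 0 = 0
         \<and> ((\<exists>\<^sub>F s in at_right 0. 0 < \<alpha>hat s) \<longrightarrow> positive_definite \<alpha>tilde)
         \<and> (\<forall>i x. PI_cost f l h i x - opt_cost f U l x \<le> ereal (\<alpha>tilde (\<beta> (\<sigma> x) i))))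
     \<and>
     ((\<forall>s\<ge>0. \<chi>W s \<le> s) \<longrightarrow>
      (let \<beta> = beta_id \<alpha>W \<alpha>Wup \<alpha>Vup;
           \<alpha>hat = alpha_hat_id \<alpha>W \<alpha>Wup \<alpha>Vup;
           \<alpha>tilde = running_max \<alpha>hat
       in class_KL \<beta> \<and> mono_on {0..} \<alpha>tilde \<and> \<alpha>tilde 0 = 0
          \<and> ((\<exists>\<^sub>F s in at_right 0. 0 < \<alpha>hat s) \<longrightarrow> positive_definite \<alpha>tilde)
          \<and> (\<forall>i x. PI_cost f l h i x - opt_cost f U l x \<le> ereal (\<alpha>tilde (\<beta> (\<sigma> x) i)))))
     \<and>
     (\<forall>cW aW aVup aWup.
        0 < cW \<and> 0 < aW \<and> 0 < aVup \<and> 0 \<le> aWup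
        \<and> (\<forall>s\<ge>0. \<chi>W s \<le> cW * s \<and> aW * s \<le> \<alpha>W s \<and> \<alpha>Vup s \<le> aVup * s \<and> \<alpha>Wup s \<le> aWup * s) \<longrightarrow>
      (let \<beta> = beta_lin cW aW aWup aVup;
           \<alpha>hat = alpha_hat_lin cW aW aWup aVup;
           \<alpha>tilde = running_max \<alpha>hat
       in ((\<exists>x. \<sigma> x \<noteq> 0) \<longrightarrow> class_KL \<beta>) \<and> mono_on {0..} \<alpha>tilde \<and> \<alpha>tilde 0 = 0
          \<and> ((\<exists>\<^sub>F s in at_right 0. 0 < \<alpha>hat s) \<longrightarrow> positive_definite \<alpha>tilde)
          \<and> (\<forall>i x. PI_cost f l h i x - opt_cost f U l x \<le> ereal (\<alpha>tilde (\<beta> (\<sigma> x) i)))))"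
proof -
  have U: "\<And>x. h 0 x \<in> U x"
    using h0_policy U_nonempty by (auto simp: selection_def)
  \<comment> \<open>Feasibility upgrades \<open>selection\<close> to membership at every point, and
    at \<open>Suc i\<close> the index shift in \<open>PI_inputs\<close> yields the cost of step
    \<open>i\<close>.\<close>
  have greedy: "\<And>i x. h (Suc i) x \<in> greedy_inputs f U l (PI_cost f l h i) x"
    using PI_selection PI_feasible unfolding selection_def PI_inputs_def
    by (metis diff_Suc_1 zero_less_Suc)
  have finite: "policy_cost f l x (h 0) < \<infinity>" for x
    using le_less_trans[OF SA3[of x], of \<infinity>] by simp
  interpret detectable_policy_iteration f U l h \<chi>W \<alpha>W \<alpha>Wup \<alpha>Vup \<sigma> W
    by unfold_locales (fact assms U greedy finite)+
  have first: "PI_cost f l h i x - opt_cost f U l x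
      \<le> PI_cost f l h 0 (closed_loop f i x hstar) - opt_cost f U l (closed_loop f i x hstar)"
    if "selection hstar (opt_inputs f U l)" for hstar i x
    using suboptimality_le[OF that, of i x] by (simp add: PI_cost_eq opt_cost_eq)
  show ?thesis
    unfolding Let_def
  proof (intro conjI allI impI)
    show "class_KL (beta_gen \<chi>W \<alpha>W \<alpha>Wup \<alpha>Vup)"
      by (rule class_KL_beta_gen)
    show "class_KL (beta_id \<alpha>W \<alpha>Wup \<alpha>Vup)"
      by (rule class_KL_beta_id)
  next
    fix i x
    show "PI_cost f l h i x - opt_cost f U l x
        \<le> ereal (running_max (alpha_hat_gen \<chi>W \<alpha>W \<alpha>Wup \<alpha>Vup) (beta_gen \<chi>W \<alpha>W \<alpha>Wup \<alpha>Vup (\<sigma> x) i))"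
      by (rule PI_bound[OF alpha_hat_gen_cont V0_diff_le_gen sigma_bound_gen])
  next
    fix i x
    assume "\<forall>s\<ge>0. \<chi>W s \<le> s"
    then show "PI_cost f l h i x - opt_cost f U l x
        \<le> ereal (running_max (alpha_hat_id \<alpha>W \<alpha>Wup \<alpha>Vup) (beta_id \<alpha>W \<alpha>Wup \<alpha>Vup (\<sigma> x) i))"
      by (intro PI_bound[OF alpha_hat_id_cont V0_diff_le_id sigma_bound_id]) auto
  next
    fix cW aW aVup aWup
    assume lin: "0 < cW \<and> 0 < aW \<and> 0 < aVup \<and> 0 \<le> aWup
        \<and> (\<forall>s\<ge>0. \<chi>W s \<le> cW * s \<and> aW * s \<le> \<alpha>W s \<and> \<alpha>Vup s \<le> aVup * s \<and> \<alpha>Wup s \<le> aWup * s)"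
    show "class_KL (beta_lin cW aW aWup aVup)" if nonzero: "\<exists>x. \<sigma> x \<noteq> 0"
    proof -
      obtain x where "\<sigma> x \<noteq> 0" using nonzero by blast
      show ?thesis
        by (rule class_KL_beta_lin[OF _ _ _ _ _ _ _ _ \<open>\<sigma> x \<noteq> 0\<close>]) (use lin in auto)
    qed
    show "PI_cost f l h i x - opt_cost f U l x
        \<le> ereal (running_max (alpha_hat_lin cW aW aWup aVup) (beta_lin cW aW aWup aVup (\<sigma> x) i))" for i x
      by (rule PI_bound[OF alpha_hat_lin_cont V0_diff_le_lin sigma_bound_lin]) (use lin in auto)
  qed (use first
      running_max_comparison[OF alpha_hat_gen_cont alpha_hat_gen_zero]
      running_max_comparison[OF alpha_hat_id_cont alpha_hat_id_zero]
      running_max_comparison[OF alpha_hat_lin_cont alpha_hat_lin_zero] in blast)+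
qed

end
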